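(* Let $\alpha$ be an action of a finite group $G$ on a unital $C^*$-algebra $M$. Then $\alpha$ is saturated if one of the following holds. (i) $\alpha$ has the Rokhlin property. (ii) $\alpha$ has the tracial Rokhlin property and $M$ has the cancellation.
   Context: **Saturated.** $M\times_\alpha G=\mathrm{span}\{x\lambda_g\mid x\in M,g\in G\}$ is the usual crossed product, with implementing unitaries $\lambda_g$, $\lambda_gx\lambda_g^*=\alpha_g(x)$. The action $\alpha$ is saturated if the closed two-sided ideal of $M\times_\alpha G$ generated by the projection $e=\frac1{|G|}\sum_{g\in G}\lambda_g$ is all of $M\times_\alpha G$. **Rokhlin property.** $\alpha$ has the Rokhlin property if for every finite set $F\subset M$ and every $\varepsilon>0$ there are mutually orthogonal projections $\{e_g\mid g\in G\}$ in $M$ such that (i) $\|\alpha_g(e_h)-e_{gh}\|<\varepsilon$ for $g,h\in G$; (ii) $\|e_gx-xe_g\|<\varepsilon$ for $g\in G$ and all $x\in F$; (iii) $\sum_{g\in G}e_g=1$. **Tracial Rokhlin property.** $\alpha$ has the tracial Rokhlin property if for every finite set $F\subset M$, every $\varepsilon>0$, every $n\in\mathbb N$, and every nonzero positive element $x\in M$ there are mutually orthogonal projections $\{e_g\mid g\in G\}$ in $M$ such that (i) $\|\alpha_g(e_h)-e_{gh}\|<\varepsilon$ for $g,h\in G$; (ii) $\|e_gy-ye_g\|<\varepsilon$ for $g\in G$ and all $y\in F$; (iii) with $e=\sum_{g\in G}e_g$, the projection $1-e$ is Murray-von Neumann equivalent to a projection in the hereditary subalgebra of $M$ generated by $x$.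 (The parameter $n$ plays no role in the conditions.) **Cancellation.** A unital $C^*$-algebra $M$ has the cancellation if, whenever $p,q,r$ are projections in $M_n(M)$ for some $n$ with $pr=0$, $qr=0$ and $p+r\sim q+r$, then $p\sim q$, where $\sim$ is Murray-von Neumann equivalence.
   Formalization: In (ii) it is additionally assumed that M is not C·1: for M = C with the trivial action of G, |G| ≥ 2, taking all e_g = 0 gives the tracial Rokhlin property and M has the cancellation, yet α is not saturated. *)

theory Defs
  imports Complex_Main "HOL-Algebra.Group" "Jordan_Normal_Form.Matrix"
begin

section \<open>Unital C*-algebras\<close>

text \<open>The class does not require \<open>0 \<noteq> 1\<close>, so the zero algebra is
  allowed; this is why it extends \<^class>\<open>real_normed_algebra\<close> and not
  \<open>real_normed_algebra_1\<close>. The real scalar multiplication of the library is tied to the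
  complex one by \<open>scaleC_of_real\<close>.\<close>

class cstar_algebra = real_normed_algebra + banach + monoid_mult +
  fixes scaleC :: "complex \<Rightarrow> 'a \<Rightarrow> 'a" (infixr \<open>*\<^sub>C\<close> 75)
    and star :: "'a \<Rightarrow> 'a"
  assumes scaleC_add_right: "a *\<^sub>C (x + y) = a *\<^sub>C x + a *\<^sub>C y"
    and scaleC_add_left: "(a + b) *\<^sub>C x = a *\<^sub>C x + b *\<^sub>C x"
    and scaleC_scaleC: "a *\<^sub>C (b *\<^sub>C x) = (a * b) *\<^sub>C x"
    and scaleC_of_real: "complex_of_real r *\<^sub>C x = r *\<^sub>R x"
    and mult_scaleC_left: "(a *\<^sub>C x) * y = a *\<^sub>C (x * y)"
    and mult_scaleC_right: "x * (a *\<^sub>C y) = a *\<^sub>C (x * y)"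
    and norm_scaleC: "norm (a *\<^sub>C x) = cmod a * norm x"
    and star_add: "star (x + y) = star x + star y"
    and star_scaleC: "star (a *\<^sub>C x) = cnj a *\<^sub>C star x"
    and star_mult: "star (x * y) = star y * star x"
    and star_star: "star (star x) = x"
    and norm_star_mult: "norm (star x * x) = (norm x)\<^sup>2"

instantiation complex :: cstar_algebra
begin
definition "scaleC_complex (a::complex) (x::complex) = a * x"
definition "star_complex = cnj"
instance
  by standard
    (auto simp: scaleC_complex_def star_complex_def algebra_simps norm_mult scaleR_conv_of_real
      power2_eq_square)
end

definition spectrum :: "'a::cstar_algebra \<Rightarrow> complex set" where
  "spectrum x = {z. \<not> (\<exists>y. y * (z *\<^sub>C 1 - x) = 1 \<and> (z *\<^sub>C 1 - x) * y = 1)}"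

definition positive_elem :: "'a::cstar_algebra \<Rightarrow> bool" where
  "positive_elem x \<longleftrightarrow> star x = x \<and> spectrum x \<subseteq> complex_of_real ` {0..}"

definition is_projection :: "'a::cstar_algebra \<Rightarrow> bool" where
  "is_projection p \<longleftrightarrow> p * p = p \<and> star p = p"

definition mvn_equiv :: "'a::cstar_algebra \<Rightarrow> 'a \<Rightarrow> bool" where
  "mvn_equiv p q \<longleftrightarrow> (\<exists>v. star v * v = p \<and> v * star v = q)"

definition cstar_subalgebra :: "'a::cstar_algebra set \<Rightarrow> bool" where
  "cstar_subalgebra B \<longleftrightarrow> closed B \<and> 0 \<in> B \<and>
     (\<forall>x\<in>B. \<forall>y\<in>B. x + y \<in> B \<and> x * y \<in> B) \<and>
     (\<forall>x\<in>B. star x \<in> B \<and> (\<forall>a. a *\<^sub>C x \<in> B))"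

definition hereditary_subalgebra :: "'a::cstar_algebra set \<Rightarrow> bool" where
  "hereditary_subalgebra B \<longleftrightarrow> cstar_subalgebra B \<and>
     (\<forall>b\<in>B. \<forall>a. positive_elem a \<and> positive_elem (b - a) \<longrightarrow> a \<in> B)"

definition hereditary_hull :: "'a::cstar_algebra \<Rightarrow> 'a set" where
  "hereditary_hull x = \<Inter>{B. hereditary_subalgebra B \<and> x \<in> B}"

section \<open>Matrices and cancellation\<close>

definition mat_star :: "'a::cstar_algebra mat \<Rightarrow> 'a mat" where
  "mat_star A = map_mat star (transpose_mat A)"

definition mat_projection :: "nat \<Rightarrow> 'a::cstar_algebra mat \<Rightarrow> bool" where
  "mat_projection n P \<longleftrightarrow> P \<in> carrier_mat n n \<and> P * P = P \<and> mat_star P = P"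

definition mat_mvn_equiv :: "nat \<Rightarrow> 'a::cstar_algebra mat \<Rightarrow> 'a mat \<Rightarrow> bool" where
  "mat_mvn_equiv n P Q \<longleftrightarrow>
     (\<exists>V\<in>carrier_mat n n. mat_star V * V = P \<and> V * mat_star V = Q)"

definition has_cancellation :: "'a::cstar_algebra itself \<Rightarrow> bool" where
  "has_cancellation (_::'a itself) \<longleftrightarrow>
     (\<forall>n. \<forall>P Q R :: 'a mat.
        mat_projection n P \<and> mat_projection n Q \<and> mat_projection n R \<and>
        P * R = 0\<^sub>m n n \<and> Q * R = 0\<^sub>m n n \<and> mat_mvn_equiv n (P + R) (Q + R)
        \<longrightarrow> mat_mvn_equiv n P Q)"

section \<open>Actions\<close>

definition star_automorphism :: "('a::cstar_algebra \<Rightarrow> 'a) \<Rightarrow> bool" where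
  "star_automorphism \<phi> \<longleftrightarrow> bij \<phi> \<and>
     (\<forall>x y. \<phi> (x + y) = \<phi> x + \<phi> y \<and> \<phi> (x * y) = \<phi> x * \<phi> y) \<and>
     (\<forall>a x. \<phi> (a *\<^sub>C x) = a *\<^sub>C \<phi> x) \<and> (\<forall>x. \<phi> (star x) = star (\<phi> x))"

definition cstar_action ::
    "('g, 'm) monoid_scheme \<Rightarrow> ('g \<Rightarrow> 'a::cstar_algebra \<Rightarrow> 'a) \<Rightarrow> bool" where
  "cstar_action G \<alpha> \<longleftrightarrow> (\<forall>g\<in>carrier G. star_automorphism (\<alpha> g)) \<and>
     (\<forall>g\<in>carrier G. \<forall>h\<in>carrier G. \<alpha> (g \<otimes>\<^bsub>G\<^esub> h) = \<alpha> g \<circ> \<alpha> h)"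

definition orthogonal_projections ::
    "('g, 'm) monoid_scheme \<Rightarrow> ('g \<Rightarrow> 'a::cstar_algebra) \<Rightarrow> bool" where
  "orthogonal_projections G e \<longleftrightarrow> (\<forall>g\<in>carrier G. is_projection (e g)) \<and>
     (\<forall>g\<in>carrier G. \<forall>h\<in>carrier G. g \<noteq> h \<longrightarrow> e g * e h = 0)"

definition rokhlin_property ::
    "('g, 'm) monoid_scheme \<Rightarrow> ('g \<Rightarrow> 'a::cstar_algebra \<Rightarrow> 'a) \<Rightarrow> bool" where
  "rokhlin_property G \<alpha> \<longleftrightarrow>
     (\<forall>(F::'a set) \<epsilon>::real. finite F \<and> 0 < \<epsilon> \<longrightarrow>
       (\<exists>e. orthogonal_projections G e \<and>
          (\<forall>g\<in>carrier G. \<forall>h\<in>carrier G. norm (\<alpha> g (e h) - e (g \<otimes>\<^bsub>G\<^esub> h)) < \<epsilon>) \<and>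
          (\<forall>g\<in>carrier G. \<forall>x\<in>F. norm (e g * x - x * e g) < \<epsilon>) \<and>
          (\<Sum>g\<in>carrier G. e g) = 1))"

text \<open>The parameter \<open>n\<close> below is part of the definition in the literature followed here,
  although nothing depends on it.\<close>

definition tracial_rokhlin_property ::
    "('g, 'm) monoid_scheme \<Rightarrow> ('g \<Rightarrow> 'a::cstar_algebra \<Rightarrow> 'a) \<Rightarrow> bool" where
  "tracial_rokhlin_property G \<alpha> \<longleftrightarrow>
     (\<forall>(F::'a set) (\<epsilon>::real) (n::nat) (x::'a).
       finite F \<and> 0 < \<epsilon> \<and> positive_elem x \<and> x \<noteq> 0 \<longrightarrow>
       (\<exists>e. orthogonal_projections G e \<and>
          (\<forall>g\<in>carrier G. \<forall>h\<in>carrier G. norm (\<alpha> g (e h) - e (g \<otimes>\<^bsub>G\<^esub> h)) < \<epsilon>) \<and>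
          (\<forall>g\<in>carrier G. \<forall>y\<in>F. norm (e g * y - y * e g) < \<epsilon>) \<and>
          (\<exists>q\<in>hereditary_hull x. is_projection q \<and>
             mvn_equiv (1 - (\<Sum>g\<in>carrier G. e g)) q)))"

section \<open>The crossed product by a finite group\<close>

text \<open>A function \<open>f\<close> supported on the carrier of \<open>G\<close> stands for the element
  \<open>\<Sum>g. f g \<lambda>\<^sub>g\<close>. The product and the involution are those forced by
  \<open>\<lambda>\<^sub>g x \<lambda>\<^sub>g\<^sup>* = \<alpha>\<^sub>g x\<close>, see \<open>crossed_covariance\<close> below. As \<open>G\<close> is finite, no
  completion is needed: these functions already form a C*-algebra.\<close>

definition crossed_carrier :: "('g, 'm) monoid_scheme \<Rightarrow> ('g \<Rightarrow> 'a::cstar_algebra) set" where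
  "crossed_carrier G = {f. \<forall>g. g \<notin> carrier G \<longrightarrow> f g = 0}"

definition crossed_mult ::
    "('g, 'm) monoid_scheme \<Rightarrow> ('g \<Rightarrow> 'a::cstar_algebra \<Rightarrow> 'a) \<Rightarrow>
     ('g \<Rightarrow> 'a) \<Rightarrow> ('g \<Rightarrow> 'a) \<Rightarrow> 'g \<Rightarrow> 'a" where
  "crossed_mult G \<alpha> f h = (\<lambda>k. if k \<in> carrier G
     then \<Sum>g\<in>carrier G. f g * \<alpha> g (h (inv\<^bsub>G\<^esub> g \<otimes>\<^bsub>G\<^esub> k)) else 0)"

definition crossed_star ::
    "('g, 'm) monoid_scheme \<Rightarrow> ('g \<Rightarrow> 'a::cstar_algebra \<Rightarrow> 'a) \<Rightarrow> ('g \<Rightarrow> 'a) \<Rightarrow> 'g \<Rightarrow> 'a" where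
  "crossed_star G \<alpha> f = (\<lambda>k. if k \<in> carrier G then \<alpha> k (star (f (inv\<^bsub>G\<^esub> k))) else 0)"

definition crossed_embed :: "('g, 'm) monoid_scheme \<Rightarrow> 'a::cstar_algebra \<Rightarrow> 'g \<Rightarrow> 'a" where
  "crossed_embed G x = (\<lambda>k. if k = \<one>\<^bsub>G\<^esub> then x else 0)"

definition crossed_unitary :: "'g \<Rightarrow> 'g \<Rightarrow> 'a::cstar_algebra" where
  "crossed_unitary g = (\<lambda>k. if k = g then 1 else 0)"

definition crossed_projection :: "('g, 'm) monoid_scheme \<Rightarrow> 'g \<Rightarrow> 'a::cstar_algebra" where
  "crossed_projection G =
     (\<lambda>k. (1 / real (card (carrier G))) *\<^sub>R (\<Sum>g\<in>carrier G. crossed_unitary g k))"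

text \<open>The norm is that of the enveloping C*-algebra: the largest C*-seminorm. Each
  C*-seminorm on the crossed product *-algebra satisfies the last condition automatically,
  since it comes from a *-representation, which is contractive on \<open>M\<close> and on the unitaries
  \<open>\<lambda>\<^sub>g\<close>; the condition is listed so that the supremum is visibly that of a bounded set.
  For a finite group this supremum is the unique C*-norm.\<close>

definition crossed_seminorm ::
    "('g, 'm) monoid_scheme \<Rightarrow> ('g \<Rightarrow> 'a::cstar_algebra \<Rightarrow> 'a) \<Rightarrow> (('g \<Rightarrow> 'a) \<Rightarrow> real) \<Rightarrow> bool" where
  "crossed_seminorm G \<alpha> N \<longleftrightarrow>
     (\<forall>f\<in>crossed_carrier G. \<forall>h\<in>crossed_carrier G.
        N (\<lambda>g. f g + h g) \<le> N f + N h \<and> N (crossed_mult G \<alpha> f h) \<le> N f * N h) \<and>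
     (\<forall>f\<in>crossed_carrier G. 0 \<le> N f \<and>
        (\<forall>a. N (\<lambda>g. a *\<^sub>C f g) = cmod a * N f) \<and>
        N (crossed_mult G \<alpha> (crossed_star G \<alpha> f) f) = (N f)\<^sup>2 \<and>
        N f \<le> (\<Sum>g\<in>carrier G. norm (f g)))"

definition crossed_norm ::
    "('g, 'm) monoid_scheme \<Rightarrow> ('g \<Rightarrow> 'a::cstar_algebra \<Rightarrow> 'a) \<Rightarrow> ('g \<Rightarrow> 'a) \<Rightarrow> real" where
  "crossed_norm G \<alpha> f = (SUP N\<in>{N. crossed_seminorm G \<alpha> N}. N f)"

definition crossed_closed_ideal ::
    "('g, 'm) monoid_scheme \<Rightarrow> ('g \<Rightarrow> 'a::cstar_algebra \<Rightarrow> 'a) \<Rightarrow> ('g \<Rightarrow> 'a) set \<Rightarrow> bool" where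
  "crossed_closed_ideal G \<alpha> J \<longleftrightarrow> J \<subseteq> crossed_carrier G \<and> (\<lambda>_. 0) \<in> J \<and>
     (\<forall>f\<in>J. \<forall>h\<in>J. (\<lambda>g. f g + h g) \<in> J) \<and>
     (\<forall>f\<in>J. \<forall>a. (\<lambda>g. a *\<^sub>C f g) \<in> J) \<and>
     (\<forall>f\<in>J. \<forall>h\<in>crossed_carrier G. crossed_mult G \<alpha> f h \<in> J \<and> crossed_mult G \<alpha> h f \<in> J) \<and>
     (\<forall>f\<in>crossed_carrier G.
        (\<forall>\<epsilon>>0. \<exists>h\<in>J. crossed_norm G \<alpha> (\<lambda>g. f g - h g) < \<epsilon>) \<longrightarrow> f \<in> J)"

definition saturated ::
    "('g, 'm) monoid_scheme \<Rightarrow> ('g \<Rightarrow> 'a::cstar_algebra \<Rightarrow> 'a) \<Rightarrow> bool" where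
  "saturated G \<alpha> \<longleftrightarrow>
     \<Inter>{J. crossed_closed_ideal G \<alpha> J \<and> crossed_projection G \<in> J} = crossed_carrier G"

lemma star_automorphism_zero: "star_automorphism \<phi> \<Longrightarrow> \<phi> 0 = 0"
  unfolding star_automorphism_def by (metis add_cancel_right_left)

lemma star_automorphism_one:
  assumes "star_automorphism \<phi>"
  shows "\<phi> 1 = 1"
proof -
  obtain u where u: "\<phi> u = 1"
    using assms unfolding star_automorphism_def by (metis bij_pointE)
  have "\<phi> (u * 1) = \<phi> u * \<phi> 1"
    using assms unfolding star_automorphism_def by blast
  with u show ?thesis by simp
qed

lemma star_one: "star (1::'a::cstar_algebra) = 1"
  by (metis mult_1_left mult_1_right star_mult star_star)

lemma star_zero: "star (0::'a::cstar_algebra) = 0"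
  by (metis add_cancel_right_left star_add)

lemma crossed_covariance:
  fixes G (structure) and \<alpha> :: "'g \<Rightarrow> 'a::cstar_algebra \<Rightarrow> 'a"
  assumes "group G" "finite (carrier G)" "cstar_action G \<alpha>" "g \<in> carrier G"
  shows "crossed_mult G \<alpha> (crossed_mult G \<alpha> (crossed_unitary g) (crossed_embed G x))
           (crossed_star G \<alpha> (crossed_unitary g)) = crossed_embed G (\<alpha> g x)"
proof -
  interpret group G by fact
  have aut: "star_automorphism (\<alpha> k)" if "k \<in> carrier G" for k
    using assms(3) that unfolding cstar_action_def by blast
  note a0 = star_automorphism_zero[OF aut] and a1 = star_automorphism_one[OF aut]
  have l: "crossed_mult G \<alpha> (crossed_unitary g) h =
      (\<lambda>k. if k \<in> carrier G then \<alpha> g (h (inv g \<otimes> k)) else 0)" for h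
  proof -
    have "(\<Sum>l\<in>carrier G. crossed_unitary g l * \<alpha> l (h (inv l \<otimes> k)))
        = (\<Sum>l\<in>carrier G. if l = g then \<alpha> l (h (inv l \<otimes> k)) else 0)" for k
      by (rule sum.cong) (auto simp: crossed_unitary_def)
    then show ?thesis
      using assms(2,4) by (auto simp: crossed_mult_def fun_eq_iff)
  qed
  have eq1: "inv g \<otimes> k = \<one> \<longleftrightarrow> k = g" if "k \<in> carrier G" for k
    using that assms(4) inv_solve_left'[of \<one> g k] by auto
  have xl: "crossed_mult G \<alpha> (crossed_unitary g) (crossed_embed G x) =
      (\<lambda>k. if k = g then \<alpha> g x else 0)"
    unfolding l using assms(4) by (auto simp: fun_eq_iff crossed_embed_def eq1 a0)
  have sl: "crossed_star G \<alpha> (crossed_unitary g) =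
      (\<lambda>k. if k = inv g then 1 else (0::'a))"
    using assms(4)
    by (auto simp: fun_eq_iff crossed_star_def crossed_unitary_def star_one star_zero a0 a1)
  have eq2: "inv g \<otimes> k = inv g \<longleftrightarrow> k = \<one>" if "k \<in> carrier G" for k
    using that assms(4) r_cancel_one[of "inv g" k] by simp
  have "(\<Sum>l\<in>carrier G. (if l = g then \<alpha> g x else 0) *
          \<alpha> l (if inv l \<otimes> k = inv g then 1 else 0))
      = (\<Sum>l\<in>carrier G. if l = g then \<alpha> g x *
          \<alpha> g (if inv g \<otimes> k = inv g then 1 else 0) else 0)" for k
    by (rule sum.cong) auto
  then have s: "(\<Sum>l\<in>carrier G. (if l = g then \<alpha> g x else 0) *
          \<alpha> l (if inv l \<otimes> k = inv g then 1 else 0))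
      = \<alpha> g x * \<alpha> g (if inv g \<otimes> k = inv g then 1 else 0)" for k
    using assms(2,4) by simp
  show ?thesis
    unfolding xl sl unfolding crossed_mult_def s crossed_embed_def
    using assms(4) by (auto simp: fun_eq_iff eq2 a0 a1)
qed

end

theory Submission
  imports Defs "HOL-Computational_Algebra.Formal_Power_Series"
begin

text \<open>If the projections \<open>e\<^sub>h\<close> are almost permuted by the action, then
  \<open>\<Sum>\<^sub>h e\<^sub>h (\<Sum>\<^sub>g \<lambda>\<^sub>g) e\<^sub>h\<close> lies in the ideal generated by the averaging projection and is
  close to \<open>f = \<Sum>\<^sub>h e\<^sub>h\<close>, because \<open>e\<^sub>h \<alpha>\<^sub>g(e\<^sub>h)\<close> is close to
  \<open>e\<^sub>h e\<^bsub>gh\<^esub> = 0\<close> for \<open>g \<noteq> 1\<close>. Under the Rokhlin property \<open>f = 1\<close>. Under the tracial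
  Rokhlin property cancellation turns \<open>1 - f \<sim> q\<close> into \<open>f \<sim> 1 - q\<close>, so the ideal almost
  contains \<open>1 - q\<close>. Two nonzero orthogonal positive elements \<open>x\<close> and \<open>y\<close> give projections \<open>p\<close> and
  \<open>q\<close> with \<open>p q = 0\<close>, and \<open>1 = (1 - p) + p (1 - q)\<close>. The C*-algebra facts needed come
  without Gelfand theory from the binomial series of \<open>sqrt (1 - x)\<close>, which converges absolutely
  on the closed unit ball.\<close>

section \<open>Square roots\<close>

lemma scaleC_one: "1 *\<^sub>C x = (x::'a::cstar_algebra)"
  using scaleC_of_real[of 1 x] by simp

lemma scaleC_zero_left: "0 *\<^sub>C x = (0::'a::cstar_algebra)"
  using scaleC_of_real[of 0 x] by simp

lemma scaleC_zero_right: "a *\<^sub>C (0::'a::cstar_algebra) = 0"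
  using scaleC_add_right[of a 0 "0::'a"] by simp

lemma scaleC_minus_right: "a *\<^sub>C (- x) = - (a *\<^sub>C (x::'a::cstar_algebra))"
  using scaleC_add_right[of a "- x" x] by (simp add: scaleC_zero_right add_eq_0_iff)

lemma scaleC_minus_left: "(- a) *\<^sub>C x = - (a *\<^sub>C (x::'a::cstar_algebra))"
  using scaleC_add_left[of "- a" a x] by (simp add: scaleC_zero_left add_eq_0_iff)

lemma scaleC_diff_right: "a *\<^sub>C (x - y) = a *\<^sub>C x - a *\<^sub>C (y::'a::cstar_algebra)"
  using scaleC_add_right[of a x "- y"] by (simp add: scaleC_minus_right)

lemma scaleC_diff_left: "(a - b) *\<^sub>C x = a *\<^sub>C x - b *\<^sub>C (x::'a::cstar_algebra)"
  using scaleC_add_left[of a "- b" x] by (simp add: scaleC_minus_left)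

lemma scaleC_scaleR: "a *\<^sub>C (r *\<^sub>R x) = r *\<^sub>R (a *\<^sub>C (x::'a::cstar_algebra))"
  by (simp add: scaleC_scaleC mult.commute flip: scaleC_of_real)

lemma star_minus: "star (- x) = - star (x::'a::cstar_algebra)"
  using star_add[of "- x" x] by (simp add: star_zero add_eq_0_iff)

lemma star_diff: "star (x - y) = star x - star (y::'a::cstar_algebra)"
  using star_add[of x "- y"] by (simp add: star_minus)

lemma star_scaleR: "star (r *\<^sub>R x) = r *\<^sub>R star (x::'a::cstar_algebra)"
  by (metis complex_cnj_complex_of_real scaleC_of_real star_scaleC)

lemma star_power: "star (x ^ n) = star (x::'a::cstar_algebra) ^ n"
  by (induction n) (simp_all add: star_one star_mult power_commutes)

lemma norm_star: "norm (star x) = norm (x::'a::cstar_algebra)"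
proof -
  have le: "norm x \<le> norm (star x)" for x :: 'a
  proof (cases "norm x = 0")
    case False
    have "norm x * norm x \<le> norm (star x) * norm x"
      using norm_mult_ineq[of "star x" x] by (simp add: norm_star_mult power2_eq_square)
    then show ?thesis using False by simp
  qed simp
  show ?thesis using le[of x] le[of "star x"] by (simp add: star_star)
qed

lemma bounded_linear_star: "bounded_linear (star :: 'a::cstar_algebra \<Rightarrow> 'a)"
  by (rule bounded_linear_intro[where K = 1]) (simp_all add: star_add star_scaleR norm_star)

lemma star_mult_self_eq_0: "star x * x = 0 \<Longrightarrow> x = (0::'a::cstar_algebra)"
  using norm_star_mult[of x] by simp

lemma norm_projection_le_1: "is_projection p \<Longrightarrow> norm (p::'a::cstar_algebra) \<le> 1"
  using norm_star_mult[of p] unfolding is_projection_def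
  by (cases "norm p = 0") (auto simp: power2_eq_square)

lemma norm_one_le_1: "norm (1::'a::cstar_algebra) \<le> 1"
  by (rule norm_projection_le_1) (simp add: is_projection_def star_one)

lemma norm_power_le_1: "norm x \<le> 1 \<Longrightarrow> norm (x ^ n) \<le> 1" for x :: "'a::cstar_algebra"
proof (induction n)
  case (Suc n)
  then show ?case
    using norm_mult_ineq[of x "x ^ n"] by (simp add: mult_le_one order_trans)
qed (simp add: norm_one_le_1)

text \<open>The defect \<open>d = w - w * star w * w\<close> satisfies
  \<open>star d * d = 0\<close>, and the C*-identity then kills \<open>d\<close>.\<close>

lemma star_mult_imp_partial_isometry:
  assumes "is_projection (star w * w)"
  shows "w * star w * w = (w::'a::cstar_algebra)"
proof -
  have p: "star w * (w * (star w * w)) = star w * w"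
    using assms by (simp add: is_projection_def mult.assoc)
  have "star (w - w * star w * w) * (w - w * star w * w) = 0"
    by (simp add: star_diff star_mult star_star algebra_simps p)
  then show ?thesis using star_mult_self_eq_0 by fastforce
qed

section \<open>Coefficients of the power series of sqrt(1 - x)\<close>

definition sqrt_coeff :: "nat \<Rightarrow> real" where
  "sqrt_coeff n = (-1) ^ n * ((1/2) gchoose n)"

lemma sqrt_coeff_0: "sqrt_coeff 0 = 1"
  by (simp add: sqrt_coeff_def)

text \<open>In the rising factorial of -1/2 only the first factor is negative.\<close>

lemma sqrt_coeff_Suc_nonpos: "sqrt_coeff (Suc n) \<le> 0"
proof -
  have "sqrt_coeff (Suc n) = pochhammer (- (1/2)) (Suc n) / fact (Suc n)"
    unfolding sqrt_coeff_def gbinomial_pochhammer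
    by (simp flip: power_mult_distrib mult.assoc)
  also have "pochhammer (- (1/2)) (Suc n) = - (1/2) * pochhammer (1/2 :: real) n"
    by (simp add: pochhammer_rec)
  also have "\<dots> / fact (Suc n) \<le> 0"
    by (intro divide_nonpos_nonneg) (simp_all add: pochhammer_nonneg)
  finally show ?thesis .
qed

text \<open>Partial sums of the coefficients are the coefficients of sqrt(1 - x) / (1 - x) = (1 -
  x)^(-1/2), which are rising factorials of 1/2 over factorials.\<close>

lemma sum_sqrt_coeff_nonneg: "0 \<le> (\<Sum>k\<le>n. sqrt_coeff k)"
proof -
  have "(\<Sum>k\<le>n. sqrt_coeff k) = (- 1) ^ n * ((1/2 - 1 :: real) gchoose n)"
    unfolding sqrt_coeff_def by (subst gbinomial_sum_lower_neg[symmetric]) (simp add: mult.commute)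
  also have "\<dots> = pochhammer (1/2) n / fact n"
    unfolding gbinomial_pochhammer by (simp flip: power_mult_distrib mult.assoc)
  finally show ?thesis by (simp add: pochhammer_nonneg)
qed

text \<open>The constant coefficient is 1 and the later ones are nonpositive, so nonnegative partial
  sums bound the absolute tail by 1. This gives convergence up to the boundary of the unit
  ball.\<close>

lemma sum_abs_sqrt_coeff: "(\<Sum>k<n. \<bar>sqrt_coeff (Suc k)\<bar>) \<le> 1"
proof -
  have "(\<Sum>k<n. \<bar>sqrt_coeff (Suc k)\<bar>) = - (\<Sum>k<n. sqrt_coeff (Suc k))"
    by (simp add: sum_negf[symmetric] abs_of_nonpos sqrt_coeff_Suc_nonpos)
  also have "\<dots> = 1 - (\<Sum>k\<le>n. sqrt_coeff k)"
    unfolding lessThan_Suc_atMost[symmetric] sum.lessThan_Suc_shift by (simp add: sqrt_coeff_0)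
  finally show ?thesis using sum_sqrt_coeff_nonneg[of n] by simp
qed

lemma summable_sqrt_coeff_Suc: "summable (\<lambda>n. \<bar>sqrt_coeff (Suc n)\<bar>)"
  by (rule summableI_nonneg_bounded[OF _ sum_abs_sqrt_coeff]) simp

lemma summable_sqrt_coeff: "summable (\<lambda>n. \<bar>sqrt_coeff n\<bar>)"
  using summable_sqrt_coeff_Suc by (subst summable_Suc_iff[symmetric])

text \<open>Vandermonde convolution: the square of the series of (1 - x)^(1/2) is 1 - x.\<close>

lemma sqrt_coeff_convolution:
  "(\<Sum>k\<le>n. sqrt_coeff k * sqrt_coeff (n - k)) = (if n = 0 then 1 else if n = 1 then -1 else 0)"
proof -
  have "(\<Sum>k\<le>n. sqrt_coeff k * sqrt_coeff (n - k))
      = (\<Sum>k\<le>n. (-1) ^ n * ((1/2 gchoose k) * (1/2 gchoose (n - k))))"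
  proof (rule sum.cong)
    fix k assume "k \<in> {..n}"
    then have "(-1) ^ n = (-1) ^ k * ((-1) ^ (n - k) :: real)"
      by (simp flip: power_add)
    then show "sqrt_coeff k * sqrt_coeff (n - k)
        = (-1) ^ n * ((1/2 gchoose k) * (1/2 gchoose (n - k)))"
      by (simp add: sqrt_coeff_def)
  qed simp
  also have "\<dots> = (-1) ^ n * ((1/2 + 1/2 :: real) gchoose n)"
    by (simp only: gbinomial_Vandermonde[symmetric] sum_distrib_left atMost_atLeast0)
  also have "\<dots> = (-1) ^ n * real (1 choose n)"
    by (simp add: binomial_gbinomial)
  also have "\<dots> = (if n = 0 then 1 else if n = 1 then -1 else 0)"
    by (auto simp: binomial_eq_0)
  finally show ?thesis .
qed

text \<open>\<open>k\<close> is the binomial series of sqrt(1 - x). The bound on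
  \<open>1 - k\<close> lets \<open>k\<close> have a square root in turn; the commutation clause
  replaces functional calculus when several roots are combined.\<close>

lemma sqrt_one_minus:
  fixes x :: "'a::cstar_algebra"
  assumes sa: "star x = x" and x: "norm x \<le> 1"
  obtains k where "star k = k" "k * k = 1 - x" "norm (1 - k) \<le> 1"
    "\<And>y. x * y = y * x \<Longrightarrow> k * y = y * k"
proof -
  define t where "t n = sqrt_coeff n *\<^sub>R x ^ n" for n
  have nt: "norm (t n) \<le> \<bar>sqrt_coeff n\<bar>" for n
    using norm_power_le_1[OF x, of n] by (simp add: t_def mult_left_le)
  have sn: "summable (\<lambda>n. norm (t n))"
    by (rule summable_comparison_test'[OF summable_sqrt_coeff, of 0]) (simp add: nt)
  then have s: "summable t" by (rule summable_norm_cancel)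
  define k where "k = suminf t"
  have "star k = k"
    unfolding k_def bounded_linear.suminf[OF bounded_linear_star s]
    unfolding t_def by (simp add: star_scaleR star_power sa)
  moreover have "k * k = 1 - x"
  proof -
    have "(\<Sum>i\<le>n. t i * t (n - i)) = (if n = 0 then 1 else if n = 1 then - x else 0)" for n
    proof -
      have "(\<Sum>i\<le>n. t i * t (n - i)) = (\<Sum>i\<le>n. (sqrt_coeff i * sqrt_coeff (n - i)) *\<^sub>R x ^ n)"
        by (rule sum.cong) (auto simp: t_def simp flip: power_add)
      then show ?thesis
        by (simp add: scaleR_sum_left[symmetric] sqrt_coeff_convolution)
    qed
    then have "k * k = (\<Sum>n. if n = 0 then 1 else if n = 1 then - x else 0)"
      using Cauchy_product[OF sn sn] by (simp add: k_def)
    also have "\<dots> = (\<Sum>n\<in>{0, 1::nat}. if n = 0 then 1 else if n = 1 then - x else 0)"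
      by (rule suminf_finite) auto
    finally show ?thesis by simp
  qed
  moreover have "norm (1 - k) \<le> 1"
  proof -
    \<comment> \<open>Dropping the constant term leaves coefficients of total absolute value at most
      1.\<close>
    have "k = 1 + (\<Sum>n. t (Suc n))"
      using suminf_split_head[OF s] by (simp add: k_def t_def sqrt_coeff_0)
    then have "norm (1 - k) = norm (\<Sum>n. t (Suc n))" by simp
    also have "\<dots> \<le> (\<Sum>n. norm (t (Suc n)))"
      by (rule summable_norm) (simp add: sn summable_Suc_iff[where f = "\<lambda>n. norm (t n)"])
    also have "\<dots> \<le> (\<Sum>n. \<bar>sqrt_coeff (Suc n)\<bar>)"
      by (rule suminf_le[OF nt _ summable_sqrt_coeff_Suc])
         (simp add: sn summable_Suc_iff[where f = "\<lambda>n. norm (t n)"])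
    also have "\<dots> \<le> 1"
      by (rule suminf_le_const[OF summable_sqrt_coeff_Suc sum_abs_sqrt_coeff])
    finally show ?thesis .
  qed
  moreover have "k * y = y * k" if xy: "x * y = y * x" for y
  proof -
    have "x ^ n * y = y * x ^ n" for n
      by (induction n) (simp_all, metis mult.assoc xy)
    then show ?thesis
      unfolding k_def suminf_mult[OF s, symmetric] suminf_mult2[OF s]
      by (simp add: t_def)
  qed
  ultimately show ?thesis by (rule that)
qed

text \<open>The element \<open>u = w + i m\<close> satisfies
  \<open>star u * u = t *\<^sub>R 1\<close>, and its imaginary part \<open>m\<close> has norm at
  most that of \<open>u\<close>. This is monotonicity of the norm on commuting squares, before any
  order is available.\<close>

lemma norm_le_of_squares:
  fixes w m :: "'a::cstar_algebra"
  assumes w: "star w = w" and m: "star m = m" and c: "w * m = m * w"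
    and e: "w * w + m * m = t *\<^sub>R 1" and t: "0 \<le> t"
  shows "norm (m * m) \<le> t"
proof -
  define u where "u = w + \<i> *\<^sub>C m"
  have su: "star u = w - \<i> *\<^sub>C m"
    by (simp add: u_def star_add star_scaleC w m scaleC_minus_left)
  have "star u * u = t *\<^sub>R 1"
    unfolding su by (simp add: u_def algebra_simps mult_scaleC_left mult_scaleC_right scaleC_scaleC
        scaleC_diff_right scaleC_add_right scaleC_minus_left scaleC_one c e[symmetric])
  then have "(norm u)\<^sup>2 \<le> t"
    using norm_star_mult[of u] mult_left_le[OF norm_one_le_1[where 'a='a] t] t by simp
  moreover have "norm m \<le> norm u"
  proof -
    have "(2 * \<i>) *\<^sub>C m = u - star u"
      unfolding su mult_2 scaleC_add_left by (simp add: u_def)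
    then have "2 * norm m = norm (u - star u)"
      using norm_scaleC[of "2 * \<i>" m] by (simp add: norm_mult)
    also have "\<dots> \<le> 2 * norm u"
      using norm_triangle_ineq4[of u "star u"] by (simp add: norm_star)
    finally show ?thesis by simp
  qed
  ultimately show ?thesis
    using norm_star_mult[of m] order_trans[OF power_mono[of "norm m" "norm u" 2]] by (simp add: m)
qed

text \<open>A root of \<open>1 - h * h\<close> commutes with \<open>h\<close>, and the two squares
  sum to 1, so \<open>norm_le_of_squares\<close> applies.\<close>

lemma norm_one_minus_square:
  fixes h :: "'a::cstar_algebra"
  assumes h: "star h = h" and n: "norm h \<le> 1"
  shows "norm (1 - h * h) \<le> 1"
proof -
  have "norm (h * h) \<le> 1"
    using norm_power_le_1[OF n, of 2] by (simp add: power2_eq_square)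
  then obtain k where k: "star k = k" "k * k = 1 - h * h"
    "\<And>y. h * h * y = y * (h * h) \<Longrightarrow> k * y = y * k"
    using sqrt_one_minus[of "h * h"] by (metis h star_mult)
  have "norm (k * k) \<le> 1"
    by (rule norm_le_of_squares[of h]) (simp_all add: h k mult.assoc)
  then show ?thesis by (simp add: k)
qed

text \<open>The inequality \<open>norm (t *\<^sub>R 1 - a) \<le> t\<close> is the working criterion
  for positivity of a self-adjoint \<open>a\<close>. Squares satisfy it for every \<open>t\<close>
  above their norm, by rescaling to the unit ball.\<close>

lemma norm_diff_square:
  fixes h :: "'a::cstar_algebra"
  assumes h: "star h = h" and n: "norm (h * h) \<le> t"
  shows "norm (t *\<^sub>R 1 - h * h) \<le> t"
proof (cases "t = 0")
  case False
  then have t: "t > 0" using order_trans[OF norm_ge_zero n] by simp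
  define g where "g = (1 / sqrt t) *\<^sub>R h"
  have "(norm h)\<^sup>2 \<le> t" using norm_star_mult[of h] h n by simp
  then have "norm h \<le> sqrt t" by (rule real_le_rsqrt)
  then have "norm g \<le> 1" using t by (simp add: g_def field_simps)
  moreover have "star g = g" by (simp add: g_def star_scaleR h)
  ultimately have "norm (1 - g * g) \<le> 1" by (rule norm_one_minus_square[rotated])
  moreover have "t *\<^sub>R 1 - h * h = t *\<^sub>R (1 - g * g)"
    using t by (simp add: g_def scaleR_diff_right)
  ultimately show ?thesis using t by (simp add: mult_left_le)
qed (use n in simp)

text \<open>Converse of the criterion: \<open>a = t *\<^sub>R (1 - x)\<close> with \<open>x\<close>
  in the unit ball, so sqrt(1 - x) scaled by \<open>sqrt t\<close> is a root.\<close>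

lemma sqrt_of_norm_diff:
  fixes a :: "'a::cstar_algebra"
  assumes a: "star a = a" and n: "norm (t *\<^sub>R 1 - a) \<le> t"
  obtains c where "star c = c" "c * c = a" "\<And>y. a * y = y * a \<Longrightarrow> c * y = y * c"
proof (cases "t = 0")
  case True
  with n have "a = 0" by simp
  then show ?thesis by (intro that[of 0]) (simp_all add: star_zero)
next
  case False
  then have t: "t > 0" using order_trans[OF norm_ge_zero n] by simp
  define x where "x = 1 - (1 / t) *\<^sub>R a"
  have "t *\<^sub>R 1 - a = t *\<^sub>R x" using t by (simp add: x_def scaleR_diff_right)
  then have "norm x \<le> 1" using n t by simp
  moreover have "star x = x" by (simp add: x_def star_diff star_scaleR star_one a)
  ultimately obtain k where k: "star k = k" "k * k = 1 - x"
    "\<And>y. x * y = y * x \<Longrightarrow> k * y = y * k"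
    using sqrt_one_minus[of x] by metis
  show ?thesis
  proof (rule that[of "sqrt t *\<^sub>R k"])
    show "sqrt t *\<^sub>R k * sqrt t *\<^sub>R k = a" using t by (simp add: k x_def)
    fix y assume "a * y = y * a"
    then have "x * y = y * x" by (simp add: x_def algebra_simps)
    then show "sqrt t *\<^sub>R k * y = y * sqrt t *\<^sub>R k" by (simp add: k(3))
  qed (simp add: star_scaleR k)
qed

section \<open>Invertibility and the spectrum\<close>

definition invertible_elem :: "'a::cstar_algebra \<Rightarrow> bool" where
  "invertible_elem x \<longleftrightarrow> (\<exists>y. y * x = 1 \<and> x * y = 1)"

lemma spectrum_iff: "z \<in> spectrum x \<longleftrightarrow> \<not> invertible_elem (z *\<^sub>C 1 - x)"
  by (simp add: spectrum_def invertible_elem_def)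

lemma invertible_elem_mult:
  assumes "invertible_elem x" "invertible_elem y"
  shows "invertible_elem (x * y)"
proof -
  obtain x' y' where "x' * x = 1" "x * x' = 1" "y' * y = 1" "y * y' = 1"
    using assms unfolding invertible_elem_def by blast
  then have "y' * x' * (x * y) = 1" "x * y * (y' * x') = 1"
    by (metis mult.assoc mult_1_left)+
  then show ?thesis unfolding invertible_elem_def by blast
qed

text \<open>Commutation turns an inverse \<open>y\<close> of \<open>a * b\<close> into a left
  inverse \<open>y * b\<close> and a right inverse \<open>b * y\<close> of \<open>a\<close>, which
  must coincide.\<close>

lemma invertible_elem_factor:
  assumes c: "a * b = b * a" and "invertible_elem (a * b)"
  shows "invertible_elem a"
proof -
  obtain y where y: "y * (a * b) = 1" "a * b * y = 1"
    using assms(2) unfolding invertible_elem_def by blast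
  then have "y * b * a = 1" "a * (b * y) = 1"
    by (metis mult.assoc c)+
  moreover from this have "y * b = b * y" by (metis mult.assoc mult_1_left mult_1_right)
  ultimately show ?thesis unfolding invertible_elem_def by metis
qed

lemma invertible_elem_scaleR:
  assumes "r \<noteq> 0" "invertible_elem x"
  shows "invertible_elem (r *\<^sub>R x)"
proof -
  obtain y where "y * x = 1" "x * y = 1" using assms(2) unfolding invertible_elem_def by blast
  then have "((1 / r) *\<^sub>R y) * (r *\<^sub>R x) = 1 \<and> (r *\<^sub>R x) * ((1 / r) *\<^sub>R y) = 1"
    using assms(1) by simp
  then show ?thesis unfolding invertible_elem_def by blast
qed

text \<open>The inverse is the Neumann series.\<close>

lemma invertible_elem_one_minus:
  fixes x :: "'a::cstar_algebra"
  assumes "norm x < 1"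
  shows "invertible_elem (1 - x)"
proof -
  have np: "norm (x ^ n) \<le> norm x ^ n" for n
  proof (induction n)
    case (Suc n)
    have "norm (x ^ Suc n) \<le> norm x * norm (x ^ n)"
      by (simp add: norm_mult_ineq)
    also have "\<dots> \<le> norm x * norm x ^ n" by (intro mult_left_mono Suc) simp
    finally show ?case by simp
  qed (simp add: norm_one_le_1)
  have s: "summable (\<lambda>n. x ^ n)"
    by (rule summable_comparison_test'[OF summable_geometric[of "norm x"], of 0])
       (use assms np in auto)
  define y where "y = (\<Sum>n. x ^ n)"
  have y: "y = 1 + (\<Sum>n. x ^ Suc n)"
    using suminf_split_head[OF s] by (simp add: y_def)
  have "(\<Sum>n. x ^ Suc n) = x * y"
    using suminf_mult[OF s, of x] by (simp add: y_def)
  moreover have "(\<Sum>n. x ^ Suc n) = y * x"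
    using suminf_mult2[OF s, of x] by (simp add: y_def power_commutes)
  ultimately have "y * (1 - x) = 1" "(1 - x) * y = 1"
    using y by (simp_all add: algebra_simps)
  then show ?thesis unfolding invertible_elem_def by blast
qed

lemma invertible_elem_norm_less:
  fixes x :: "'a::cstar_algebra"
  assumes "norm x < t"
  shows "invertible_elem (t *\<^sub>R 1 - x)"
proof -
  have t: "t > 0" using assms norm_ge_zero[of x] by linarith
  then have "t *\<^sub>R 1 - x = t *\<^sub>R (1 - (1 / t) *\<^sub>R x)" by (simp add: scaleR_diff_right)
  moreover have "invertible_elem (1 - (1 / t) *\<^sub>R x)"
    using t assms by (intro invertible_elem_one_minus) simp
  ultimately show ?thesis using t by (simp add: invertible_elem_scaleR)
qed

text \<open>With \<open>s = norm (d * d)\<close> the element is \<open>(s + r) *\<^sub>R 1\<close>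
  minus \<open>s *\<^sub>R 1 - d * d\<close>, and the latter has norm at most
  \<open>s < s + r\<close>.\<close>

lemma invertible_elem_square_add:
  fixes d :: "'a::cstar_algebra"
  assumes d: "star d = d" and r: "0 < r"
  shows "invertible_elem (d * d + r *\<^sub>R 1)"
proof -
  let ?s = "norm (d * d)"
  have "invertible_elem ((?s + r) *\<^sub>R 1 - (?s *\<^sub>R 1 - d * d))"
    using norm_diff_square[OF d order_refl] r by (intro invertible_elem_norm_less) linarith
  then show ?thesis by (simp add: algebra_simps)
qed

text \<open>Multiplying by the factor with the conjugate scalar gives
  \<open>(Re z - c)^2 + (Im z)^2\<close>, a square plus a positive scalar.\<close>

lemma invertible_elem_nonreal:
  fixes c :: "'a::cstar_algebra"
  assumes c: "star c = c" and z: "Im z \<noteq> 0"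
  shows "invertible_elem (z *\<^sub>C 1 - c)"
proof (rule invertible_elem_factor)
  let ?d = "Re z *\<^sub>R 1 - c"
  have "z *\<^sub>C (1::'a) = (complex_of_real (Re z) + \<i> * complex_of_real (Im z)) *\<^sub>C 1"
    "cnj z *\<^sub>C (1::'a) = (complex_of_real (Re z) - \<i> * complex_of_real (Im z)) *\<^sub>C 1"
    by (rule arg_cong[where f = "\<lambda>u. u *\<^sub>C 1"], simp add: complex_eq_iff)+
  then have z1: "z *\<^sub>C 1 - c = ?d + \<i> *\<^sub>C (Im z *\<^sub>R 1)"
    and z2: "cnj z *\<^sub>C 1 - c = ?d - \<i> *\<^sub>C (Im z *\<^sub>R 1)"
    by (simp_all add: scaleC_add_left scaleC_diff_left flip: scaleC_of_real scaleC_scaleC)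
  show "(z *\<^sub>C 1 - c) * (cnj z *\<^sub>C 1 - c) = (cnj z *\<^sub>C 1 - c) * (z *\<^sub>C 1 - c)"
    by (simp add: algebra_simps mult_scaleC_left mult_scaleC_right scaleC_scaleC scaleC_diff_right)
  have "(z *\<^sub>C 1 - c) * (cnj z *\<^sub>C 1 - c) = ?d * ?d + (Im z)\<^sup>2 *\<^sub>R 1"
    unfolding z1 z2
    by (simp add: algebra_simps mult_scaleC_left mult_scaleC_right scaleC_scaleC
        scaleC_diff_right scaleC_add_right scaleC_scaleR scaleC_minus_left scaleC_one
        power2_eq_square)
  moreover have "star ?d = ?d" by (simp add: star_diff star_scaleR star_one c)
  ultimately show "invertible_elem ((z *\<^sub>C 1 - c) * (cnj z *\<^sub>C 1 - c))"
    using z by (simp add: invertible_elem_square_add)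
qed

lemma spectrum_self_adjoint_real:
  assumes "star c = c" "z \<in> spectrum c"
  shows "z = complex_of_real (Re z)"
  using invertible_elem_nonreal[OF assms(1), of z] assms(2)
  by (auto simp: spectrum_iff complex_eq_iff)

text \<open>Factor \<open>z - c * c\<close> as \<open>(w - c) (w + c)\<close> with
  \<open>w * w = z\<close>. A nonreal \<open>w\<close> makes both factors invertible, so on the
  spectrum \<open>w\<close> is real and \<open>z\<close> is its square.\<close>

lemma positive_elem_square:
  fixes c :: "'a::cstar_algebra"
  assumes c: "star c = c"
  shows "positive_elem (c * c)"
  unfolding positive_elem_def
proof (intro conjI subsetI)
  fix z assume z: "z \<in> spectrum (c * c)"
  define w where "w = csqrt z"
  have w: "w * w = z" using power2_csqrt[of z] by (simp add: w_def power2_eq_square)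
  have "z *\<^sub>C 1 - c * c = (w *\<^sub>C 1 - c) * (w *\<^sub>C 1 - (- c))"
    by (simp add: algebra_simps mult_scaleC_left mult_scaleC_right scaleC_scaleC
        scaleC_diff_right w)
  then have "Im w = 0"
    using z invertible_elem_nonreal[OF c, of w] invertible_elem_nonreal[of "- c" w]
    by (auto simp: spectrum_iff star_minus c intro: invertible_elem_mult)
  then have "z = complex_of_real (Re w * Re w)"
    unfolding w[symmetric] by (simp add: complex_eq_iff)
  then show "z \<in> complex_of_real ` {0..}" by (rule image_eqI) simp
qed (simp add: star_mult c)

lemma positive_elem_invertible:
  assumes "positive_elem a" "0 < r"
  shows "invertible_elem (r *\<^sub>R 1 + a)"
proof -
  have "complex_of_real (- r) \<notin> spectrum a"
    using assms unfolding positive_elem_def by (auto simp flip: of_real_minus)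
  then have "invertible_elem ((- r) *\<^sub>R 1 - a)"
    by (simp add: spectrum_iff scaleC_of_real flip: of_real_minus)
  from invertible_elem_scaleR[OF _ this, of "-1"] show ?thesis by (simp add: add.commute)
qed

text \<open>An invertible positive \<open>p\<close> dominates \<open>1 / R\<close>, where
  \<open>R\<close> is the norm of its inverse. For \<open>p = t - c * c\<close> with
  \<open>t = norm (c * c)\<close> this would force \<open>norm (c * c) \<le> t - 1 / R\<close>. The
  order statement is realised by explicit commuting square roots.\<close>

lemma norm_square_in_spectrum:
  fixes c :: "'a::cstar_algebra"
  assumes c: "star c = c" and nz: "c \<noteq> 0"
  shows "\<not> invertible_elem (norm (c * c) *\<^sub>R 1 - c * c)"
proof
  define t where "t = norm (c * c)"
  define p where "p = t *\<^sub>R 1 - c * c"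
  assume "invertible_elem (norm (c * c) *\<^sub>R 1 - c * c)"
  then obtain r where r: "r * p = 1" "p * r = 1"
    unfolding invertible_elem_def p_def t_def by blast
  have t: "0 < t" using nz star_mult_self_eq_0[of c] c unfolding t_def by auto
  have sp: "star p = p" by (simp add: p_def star_diff star_scaleR star_mult star_one c)
  have rinv: "r * y = y * r" if "p * y = y * p" for y
    by (metis that r mult.assoc mult_1_left mult_1_right)
  have sr: "star r = r"
    by (metis mult.assoc mult_1_left mult_1_right r sp star_mult star_one)
  have pc: "p * c = c * p" by (simp add: p_def algebra_simps)
  have "norm (t *\<^sub>R 1 - p) \<le> t" by (simp add: p_def t_def)
  then obtain k where k: "star k = k" "k * k = p" "\<And>y. p * y = y * p \<Longrightarrow> k * y = y * k"
    using sqrt_of_norm_diff[OF sp] by metis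
  have kr: "k * r = r * k" by (rule k(3)) (simp add: r)
  have kc: "k * c = c * k" by (rule k(3)[OF pc])
  have rc: "r * c = c * r" by (rule rinv[OF pc])
  define R where "R = norm r"
  have "r \<noteq> 0" using r nz by (metis mult_1_right mult_zero_left mult_zero_right)
  then have R: "0 < R" by (simp add: R_def)
  have "(k * r) * (k * r) = k * k * r * r" by (metis kr mult.assoc)
  then have krr: "(k * r) * (k * r) = r" by (simp add: k(2) r)
  have "norm (R *\<^sub>R 1 - k * r * (k * r)) \<le> R"
    by (rule norm_diff_square) (simp add: star_mult sr k(1) kr, simp only: krr R_def)
  then have "norm (R *\<^sub>R 1 - (R *\<^sub>R 1 - r)) \<le> R" "norm (R *\<^sub>R 1 - r) \<le> R"
    unfolding krr by (simp_all add: R_def)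
  \<comment> \<open>\<open>R - r\<close> meets the positivity criterion at \<open>t = R\<close>,
    since \<open>r\<close> has norm \<open>R\<close>.\<close>
  then obtain s where s: "star s = s" "s * s = R *\<^sub>R 1 - r"
      "\<And>y. (R *\<^sub>R 1 - r) * y = y * (R *\<^sub>R 1 - r) \<Longrightarrow> s * y = y * s"
    using sqrt_of_norm_diff[of "R *\<^sub>R 1 - r" R]
    by (metis sr star_diff star_one star_scaleR)
  have sk: "s * k = k * s" by (rule s(3)) (simp add: algebra_simps kr)
  have sc: "s * c = c * s" by (rule s(3)) (simp add: algebra_simps rc)
  \<comment> \<open>As \<open>r\<close> inverts \<open>p\<close>, the square of \<open>k * s\<close>
    is \<open>p (R - r) = R p - 1\<close>; hence \<open>w\<close> is a root of
    \<open>p - 1 / R\<close>.\<close>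
  define w where "w = (1 / sqrt R) *\<^sub>R (k * s)"
  have "k * s * (k * s) = k * (s * k) * s" by (simp only: mult.assoc)
  also have "\<dots> = k * k * (s * s)" unfolding sk by (simp only: mult.assoc)
  finally have "k * s * (k * s) = R *\<^sub>R p - 1" by (simp add: k(2) s(2) right_diff_distrib r)
  then have ww: "w * w = p - (1 / R) *\<^sub>R 1" using R by (simp add: w_def scaleR_diff_right)
  have "norm (c * c) \<le> t - 1 / R"
  proof (rule norm_le_of_squares)
    show "star w = w" by (simp add: w_def star_scaleR star_mult k(1) s(1) sk)
    show "w * c = c * w" by (simp add: w_def) (metis kc sc mult.assoc)
    show "w * w + c * c = (t - 1 / R) *\<^sub>R 1" by (simp add: ww p_def algebra_simps)
    \<comment> \<open>Nonnegativity of \<open>t - 1 / R\<close> comes from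
      \<open>1 = norm (p * r) \<le> t * R\<close>, for which the unit must have norm 1.\<close>
    have "(norm (1::'a))\<^sup>2 = norm (1::'a)" using norm_star_mult[of "1::'a"] by (simp add: star_one)
    moreover have "(1::'a) \<noteq> 0" using nz by (metis mult_1_right mult_zero_right)
    ultimately have "norm (1::'a) = 1" by (simp add: power2_eq_square)
    then have "1 \<le> norm p * R" using norm_mult_ineq[of p r] by (simp add: r R_def)
    also have "\<dots> \<le> t * R"
      using R norm_diff_square[OF c order_refl] by (simp add: p_def t_def)
    finally show "0 \<le> t - 1 / R" using R by (simp add: field_simps)
  qed (rule c)
  with R show False by (simp add: t_def)
qed

text \<open>Since \<open>l - p\<close> divides \<open>l^3 - p^3\<close>, a spectral value
  \<open>l\<close> of \<open>p\<close> puts \<open>l^3\<close> in the spectrum of the square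
  \<open>d * d\<close>. Cubes appear because those of positive and negative parts are visibly
  squares.\<close>

lemma positive_elem_of_cube:
  fixes p :: "'a::cstar_algebra"
  assumes p: "star p = p" and d: "star d = d" "p * p * p = d * d"
  shows "positive_elem p"
  unfolding positive_elem_def
proof (intro conjI subsetI)
  fix z assume z: "z \<in> spectrum p"
  define l where "l = Re z"
  have zl: "z = complex_of_real l" using spectrum_self_adjoint_real[OF p z] by (simp add: l_def)
  let ?a = "l *\<^sub>R 1 - p" and ?b = "l\<^sup>2 *\<^sub>R 1 + l *\<^sub>R p + p * p"
  have "\<not> invertible_elem ?a" using z by (simp add: spectrum_iff zl scaleC_of_real)
  moreover have "?a * ?b = ?b * ?a" by (simp add: algebra_simps)
  moreover have "?a * ?b = (l ^ 3) *\<^sub>R 1 - d * d"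
    by (simp add: algebra_simps power2_eq_square power3_eq_cube flip: d(2))
  ultimately have "\<not> invertible_elem ((l ^ 3) *\<^sub>R 1 - d * d)"
    using invertible_elem_factor by metis
  then have "complex_of_real (l ^ 3) \<in> spectrum (d * d)"
    by (simp only: spectrum_iff scaleC_of_real not_False_eq_True)
  then obtain r where "complex_of_real (l ^ 3) = complex_of_real r" "0 \<le> r"
    using positive_elem_square[OF d(1)] unfolding positive_elem_def by blast
  then have "0 \<le> l ^ 3" by (simp only: of_real_eq_iff)
  then show "z \<in> complex_of_real ` {0..}" by (simp add: zl zero_le_power_eq)
qed (rule p)

section \<open>Positive elements\<close>

text \<open>After scaling to \<open>norm g = 1\<close>, \<open>m\<close> is the absolute value
  sqrt(g^2), and \<open>P = m + g\<close>, \<open>N = m - g\<close> are twice the positive and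
  negative parts of \<open>g\<close>. Roots of \<open>p + n\<close> and \<open>n^3\<close> are
  recorded because a positive element is not yet known to be a square.\<close>

lemma positive_decomposition:
  fixes h :: "'a::cstar_algebra"
  assumes h: "star h = h"
  obtains p n c d where "star p = p" "star n = n" "positive_elem p" "positive_elem n"
    "h = p - n" "p * n = 0" "n * p = 0" "star c = c" "p + n = c * c"
    "star d = d" "n * n * n = d * d"
proof (cases "h = 0")
  case True
  have "positive_elem (0::'a)" using positive_elem_square[of "0::'a"] by (simp add: star_zero)
  then show ?thesis using True by (intro that[of 0 0 0 0]) (simp_all add: star_zero)
next
  case False
  define g where "g = (1 / norm h) *\<^sub>R h"
  have g: "star g = g" "norm g \<le> 1" using False by (simp_all add: g_def star_scaleR h)
  have "star (1 - g * g) = 1 - g * g" by (simp add: star_diff star_one star_mult g(1))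
  then obtain m where m: "star m = m" "m * m = 1 - (1 - g * g)" "norm (1 - m) \<le> 1"
      "\<And>y. (1 - g * g) * y = y * (1 - g * g) \<Longrightarrow> m * y = y * m"
    using sqrt_one_minus[OF _ norm_one_minus_square[OF g]] by blast
  have "norm (1 *\<^sub>R 1 - m) \<le> 1" using m(3) by simp
  then obtain r where r: "star r = r" "r * r = m" "\<And>y. m * y = y * m \<Longrightarrow> r * y = y * r"
    using sqrt_of_norm_diff[OF m(1)] by metis
  have mg: "m * g = g * m" by (rule m(4)) (simp add: algebra_simps)
  have rg: "r * g = g * r" by (rule r(3)[OF mg])
  have rm: "r * m = m * r" by (rule r(3)) simp
  \<comment> \<open>With \<open>r\<close> a root of \<open>m\<close> commuting with
    \<open>x\<close>, the cube is \<open>2 m x^2 = 2 (r x)^2\<close>.\<close>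
  have cube: "x * x * x = (sqrt 2 *\<^sub>R (r * x)) * (sqrt 2 *\<^sub>R (r * x))"
    if x: "x * x = 2 *\<^sub>R (m * x)" "r * x = x * r" for x
  proof -
    have "r * x * (r * x) = r * (x * r) * x" by (simp only: mult.assoc)
    also have "\<dots> = m * x * x" unfolding x(2)[symmetric] by (simp only: mult.assoc flip: r(2))
    finally show ?thesis by (simp add: x)
  qed
  \<comment> \<open>\<open>P - N = 2 g\<close>, so this factor recovers \<open>h\<close> as the
    difference of the scaled parts.\<close>
  define q where "q = norm h / 2"
  have q: "q > 0" using False by (simp add: q_def)
  define P where "P = m + g"
  define N where "N = m - g"
  have sPN: "star P = P" "star N = N" by (simp_all add: P_def N_def star_add star_diff m(1) g(1))
  have PN: "P * N = 0" "N * P = 0" by (simp_all add: P_def N_def algebra_simps mg m(2))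
  have rPN: "r * P = P * r" "r * N = N * r"
    by (simp_all add: P_def N_def algebra_simps rg rm)
  \<comment> \<open>\<open>P * P = P * (P + N)\<close> because \<open>P * N = 0\<close>, and
    \<open>P + N = 2 m\<close>; likewise for \<open>N\<close>.\<close>
  have "P * P = 2 *\<^sub>R (m * P)" "N * N = 2 *\<^sub>R (m * N)"
    by (simp_all add: P_def N_def algebra_simps mg m(2) scaleR_2)
  note cubes = cube[OF this(1) rPN(1)] cube[OF this(2) rPN(2)]
  have sr: "star (sqrt 2 *\<^sub>R (r * P)) = sqrt 2 *\<^sub>R (r * P)"
      "star (sqrt 2 *\<^sub>R (r * N)) = sqrt 2 *\<^sub>R (r * N)"
    by (simp_all add: star_scaleR star_mult sPN r(1) rPN)
  have cube_q: "(q *\<^sub>R x) * (q *\<^sub>R x) * (q *\<^sub>R x) = ((sqrt q * q) *\<^sub>R y) * ((sqrt q * q) *\<^sub>R y)"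
    if "x * x * x = y * y" for x y :: 'a
    using q that by (simp add: algebra_simps)
  show ?thesis
  proof (rule that[of "q *\<^sub>R P" "q *\<^sub>R N" "sqrt (2 * q) *\<^sub>R r" "(sqrt q * q) *\<^sub>R (sqrt 2 *\<^sub>R (r * N))"])
    show "positive_elem (q *\<^sub>R P)"
      by (rule positive_elem_of_cube[OF _ _ cube_q[OF cubes(1)]])
         (simp_all only: star_scaleR[of "sqrt q * q"] star_scaleR[of q] sr sPN)
    show "positive_elem (q *\<^sub>R N)"
      by (rule positive_elem_of_cube[OF _ _ cube_q[OF cubes(2)]])
         (simp_all only: star_scaleR[of "sqrt q * q"] star_scaleR[of q] sr sPN)
    show "q *\<^sub>R N * (q *\<^sub>R N) * (q *\<^sub>R N) = ((sqrt q * q) *\<^sub>R (sqrt 2 *\<^sub>R (r * N))) *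
        ((sqrt q * q) *\<^sub>R (sqrt 2 *\<^sub>R (r * N)))"
      by (rule cube_q[OF cubes(2)])
    show "star ((sqrt q * q) *\<^sub>R (sqrt 2 *\<^sub>R (r * N))) = (sqrt q * q) *\<^sub>R (sqrt 2 *\<^sub>R (r * N))"
      by (simp only: star_scaleR[of "sqrt q * q"] sr)
    show "h = q *\<^sub>R P - q *\<^sub>R N"
      using False by (simp add: P_def N_def q_def g_def algebra_simps flip: scaleR_left.add)
    show "q *\<^sub>R P + q *\<^sub>R N = sqrt (2 * q) *\<^sub>R r * sqrt (2 * q) *\<^sub>R r"
      using q by (simp add: P_def N_def r(2) algebra_simps flip: scaleR_left.add)
  qed (simp_all add: star_scaleR sPN PN r(1))
qed

text \<open>A nonnegative spectrum must kill the negative part \<open>n\<close> of \<open>a\<close>.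
  Otherwise the norm \<open>l^3\<close> of \<open>n^3 = d * d\<close> lies in the spectrum of
  \<open>d * d\<close>, although \<open>l^3 - n^3\<close> factors into two invertible
  elements.\<close>

lemma positive_elem_iff_square:
  "positive_elem a \<longleftrightarrow> (\<exists>c. star c = c \<and> a = c * (c::'a::cstar_algebra))"
proof
  assume pos: "positive_elem a"
  then have "star a = a" by (simp add: positive_elem_def)
  then obtain p n c d where d: "star p = p" "star n = n" "positive_elem p"
    "a = p - n" "p * n = 0" "n * p = 0" "star c = c" "p + n = c * c"
    "star d = d" "n * n * n = d * d"
    by (metis positive_decomposition)
  have "n = 0"
  proof (rule ccontr)
    assume n: "n \<noteq> 0"
    have "n * n \<noteq> 0" using n star_mult_self_eq_0[of n] d(2) by auto
    then have "n * n * (n * n) \<noteq> 0" using star_mult_self_eq_0[of "n * n"] d(2)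
      by (auto simp: star_mult)
    then have nnn: "d * d \<noteq> 0" unfolding d(10)[symmetric] by (metis mult.assoc mult_zero_left)
    define l where "l = root 3 (norm (d * d))"
    have l: "l > 0" "l ^ 3 = norm (d * d)" using nnn by (simp_all add: l_def)
    let ?a = "l *\<^sub>R 1 - n" and ?b = "l\<^sup>2 *\<^sub>R 1 + l *\<^sub>R n + n * n"
    have ab: "?a * ?b = (l ^ 3) *\<^sub>R 1 - d * d"
      by (simp add: algebra_simps power2_eq_square power3_eq_cube flip: d(10))
    \<comment> \<open>Completing the square exhibits \<open>?b\<close> as a square plus a positive
      multiple of 1.\<close>
    let ?e = "n + (l / 2) *\<^sub>R 1"
    have "?e * ?e + (3 / 4 * l\<^sup>2) *\<^sub>R 1 = n * n + (l / 2 + l / 2) *\<^sub>R n + (l\<^sup>2 / 4 + 3 / 4 * l\<^sup>2) *\<^sub>R 1"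
      unfolding scaleR_left.add by (simp add: algebra_simps power2_eq_square)
    then have "?b = ?e * ?e + (3 / 4 * l\<^sup>2) *\<^sub>R 1" by simp
    moreover have "invertible_elem (?e * ?e + (3 / 4 * l\<^sup>2) *\<^sub>R 1)"
      using l by (intro invertible_elem_square_add) (simp_all add: star_add star_scaleR star_one d)
    ultimately have "invertible_elem ?b" by simp
    \<comment> \<open>Since \<open>p * n = 0\<close>, the product reduces to
      \<open>l (l + a)\<close>, invertible because \<open>-l\<close> is not in the spectrum of
      \<open>a\<close>.\<close>
    moreover have "(l *\<^sub>R 1 + p) * ?a = l *\<^sub>R (l *\<^sub>R 1 + a)" "?a * (l *\<^sub>R 1 + p) = l *\<^sub>R (l *\<^sub>R 1 + a)"
      by (simp_all add: algebra_simps d)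
    then have "invertible_elem ?a"
      using l positive_elem_invertible[OF pos l(1)]
      by (intro invertible_elem_factor[of ?a "l *\<^sub>R 1 + p"]) (simp_all add: invertible_elem_scaleR)
    ultimately have "invertible_elem ((l ^ 3) *\<^sub>R 1 - d * d)"
      unfolding ab[symmetric] by (rule invertible_elem_mult[rotated])
    moreover have "d \<noteq> 0" using nnn by auto
    ultimately show False using norm_square_in_spectrum[OF d(9)] unfolding l(2) by blast
  qed
  then show "\<exists>c. star c = c \<and> a = c * c" using d by auto
qed (auto intro: positive_elem_square)

section \<open>Sums, order and norm of positive elements\<close>

lemma positive_elem_star: "positive_elem a \<Longrightarrow> star a = a"
  by (simp add: positive_elem_def)

lemma positive_elem_norm_diff: "positive_elem a \<Longrightarrow> norm a \<le> t \<Longrightarrow> norm (t *\<^sub>R 1 - a) \<le> t"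
  unfolding positive_elem_iff_square by (auto intro: norm_diff_square)

lemma positive_elem_of_norm_diff:
  "star a = a \<Longrightarrow> norm (t *\<^sub>R 1 - a) \<le> t \<Longrightarrow> positive_elem a"
  unfolding positive_elem_iff_square by (metis sqrt_of_norm_diff)

lemma positive_elem_norm_not_invertible:
  "positive_elem a \<Longrightarrow> a \<noteq> 0 \<Longrightarrow> \<not> invertible_elem (norm a *\<^sub>R 1 - a)"
  unfolding positive_elem_iff_square using norm_square_in_spectrum by fastforce

text \<open>The criterion \<open>norm (t *\<^sub>R 1 - a) \<le> t\<close> is additive in
  \<open>t\<close> and \<open>a\<close> by the triangle inequality.\<close>

lemma positive_elem_add:
  assumes "positive_elem a" "positive_elem b"
  shows "positive_elem (a + b)"
proof (rule positive_elem_of_norm_diff)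
  have "(norm a + norm b) *\<^sub>R 1 - (a + b) = (norm a *\<^sub>R 1 - a) + (norm b *\<^sub>R 1 - b)"
    by (simp add: algebra_simps)
  also have "norm \<dots> \<le> norm a + norm b"
    by (intro norm_triangle_mono positive_elem_norm_diff assms order_refl)
  finally show "norm ((norm a + norm b) *\<^sub>R 1 - (a + b)) \<le> norm a + norm b" .
qed (use assms in \<open>simp add: star_add positive_elem_star\<close>)

text \<open>For nonzero positive \<open>a\<close> the element \<open>norm a *\<^sub>R 1 - a\<close>
  is not invertible, but it is a positive scalar plus \<open>- a\<close>.\<close>

lemma positive_elem_antisym:
  assumes "positive_elem a" "positive_elem (- a)"
  shows "a = 0"
proof (rule ccontr)
  assume a: "a \<noteq> 0"
  have "invertible_elem (norm a *\<^sub>R 1 + (- a))"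
    by (rule positive_elem_invertible[OF assms(2)]) (simp add: a)
  then show False using positive_elem_norm_not_invertible[OF assms(1) a] by simp
qed

text \<open>If \<open>norm a > s\<close>, then \<open>norm a - a = (norm a - s) + (s - a)\<close>
  would be invertible.\<close>

lemma positive_elem_norm_le:
  assumes "positive_elem a" "positive_elem (s *\<^sub>R 1 - a)" "0 \<le> s"
  shows "norm a \<le> s"
proof (rule ccontr)
  assume "\<not> norm a \<le> s"
  with assms(3) have "0 < norm a - s" "a \<noteq> 0" by auto
  then have "invertible_elem ((norm a - s) *\<^sub>R 1 + (s *\<^sub>R 1 - a))"
    by (intro positive_elem_invertible assms)
  then show False
    using positive_elem_norm_not_invertible[OF assms(1) \<open>a \<noteq> 0\<close>] by (simp add: algebra_simps)
qed

text \<open>An inverse \<open>u\<close> of \<open>z - x y\<close> yields the inverse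
  \<open>(1 + y u x) / z\<close> of \<open>z - y x\<close>; thus \<open>x y\<close> and
  \<open>y x\<close> share their nonzero spectrum.\<close>

lemma invertible_elem_swap:
  fixes x y :: "'a::cstar_algebra"
  assumes z: "z \<noteq> 0" and i: "invertible_elem (z *\<^sub>C 1 - x * y)"
  shows "invertible_elem (z *\<^sub>C 1 - y * x)"
proof -
  obtain u where u: "u * (z *\<^sub>C 1 - x * y) = 1" "(z *\<^sub>C 1 - x * y) * u = 1"
    using i unfolding invertible_elem_def by blast
  have u1: "z *\<^sub>C u = 1 + u * (x * y)" and u2: "z *\<^sub>C u = 1 + x * y * u"
    using u by (simp_all add: algebra_simps mult_scaleC_left mult_scaleC_right)
  have u1': "z *\<^sub>C (y * (u * x)) = y * x + y * (u * (x * (y * x)))"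
    using arg_cong[OF u1, of "\<lambda>t. y * t * x"]
    by (simp add: algebra_simps mult_scaleC_left mult_scaleC_right)
  have u2': "z *\<^sub>C (y * (u * x)) = y * x + y * (x * (y * (u * x)))"
    using arg_cong[OF u2, of "\<lambda>t. y * t * x"]
    by (simp add: algebra_simps mult_scaleC_left mult_scaleC_right)
  have "(1 + y * u * x) * (z *\<^sub>C 1 - y * x) = z *\<^sub>C 1"
    "(z *\<^sub>C 1 - y * x) * (1 + y * u * x) = z *\<^sub>C 1"
    using u1' u2'
    by (simp_all add: algebra_simps mult_scaleC_left mult_scaleC_right scaleC_add_right)
  then have "((1 / z) *\<^sub>C (1 + y * u * x)) * (z *\<^sub>C 1 - y * x) = 1"
    "(z *\<^sub>C 1 - y * x) * ((1 / z) *\<^sub>C (1 + y * u * x)) = 1"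
    using z by (simp_all add: mult_scaleC_left mult_scaleC_right scaleC_scaleC scaleC_one)
  then show ?thesis unfolding invertible_elem_def by blast
qed

lemma positive_elem_neg_swap:
  fixes v :: "'a::cstar_algebra"
  assumes "positive_elem (- (star v * v))"
  shows "positive_elem (- (v * star v))"
  unfolding positive_elem_def
proof (intro conjI subsetI)
  fix z assume z: "z \<in> spectrum (- (v * star v))"
  show "z \<in> complex_of_real ` {0..}"
  proof (cases "z = 0")
    case True
    then show ?thesis by (auto intro: image_eqI[of _ _ 0])
  next
    case False
    have "z \<in> spectrum (- (star v * v))"
      using z invertible_elem_swap[OF False, of "- star v" v] by (auto simp: spectrum_iff)
    then show ?thesis using assms unfolding positive_elem_def by blast
  qed
qed (simp add: star_minus star_mult star_star)

text \<open>Let \<open>n\<close> be the negative part of \<open>star w * w\<close> and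
  \<open>v = w * n\<close>. Then \<open>star v * v = - n^3\<close> is negative, hence so is
  \<open>v * star v\<close>, while their sum is a positive multiple of a sum of self-adjoint
  squares. This forces \<open>n = 0\<close>.\<close>

lemma positive_elem_star_mult_self: "positive_elem (star w * (w::'a::cstar_algebra))"
proof -
  have "star (star w * w) = star w * w" by (simp add: star_mult star_star)
  then obtain p n d where d: "star n = n" "positive_elem p"
    "star w * w = p - n" "n * p = 0" "star d = d" "n * n * n = d * d"
    by (metis positive_decomposition)
  define v where "v = w * n"
  have "star v * v = n * (star w * w) * n" by (simp add: v_def star_mult d(1) mult.assoc)
  then have vv: "star v * v = - (d * d)" unfolding d(3) by (simp add: right_diff_distrib d(4,6))
  then have neg: "positive_elem (- (star v * v))" by (simp add: positive_elem_square d(5))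
  note neg' = positive_elem_neg_swap[OF neg]
  \<comment> \<open>The squares of \<open>?H\<close> and \<open>?K\<close> sum to twice
    \<open>star v * v + v * star v\<close>; removing the negative \<open>v * star v\<close> twice
    shows that \<open>star v * v + star v * v\<close> is positive.\<close>
  let ?H = "v + star v" and ?K = "\<i> *\<^sub>C (v - star v)"
  have "star ?H = ?H" "star ?K = ?K"
    by (simp_all add: star_add star_diff star_star star_scaleC scaleC_minus_left
        flip: scaleC_minus_right)
  then have "positive_elem (?H * ?H + ?K * ?K + (- (v * star v) + - (v * star v)))"
    by (intro positive_elem_add positive_elem_square neg')
  moreover have "?H * ?H + ?K * ?K + (- (v * star v) + - (v * star v)) = star v * v + star v * v"
    by (simp add: algebra_simps mult_scaleC_left mult_scaleC_right scaleC_scaleC scaleC_minus_left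
        scaleC_one scaleC_diff_right)
  ultimately have "star v * v + star v * v = 0"
    using positive_elem_add[OF neg neg] positive_elem_antisym[of "star v * v + star v * v"] by simp
  then have "star v * v = 0" by (simp flip: scaleR_2)
  then have "n * n * n = 0" using vv d by simp
  then have "star (n * n) * (n * n) = 0" by (simp add: star_mult d(1)) (metis mult.assoc mult_zero_left)
  then have "star n * n = 0" using star_mult_self_eq_0[of "n * n"] by (simp add: d(1))
  then have "n = 0" by (rule star_mult_self_eq_0)
  then show ?thesis using d by simp
qed

section \<open>Orthogonal hereditary subalgebras and cancellation\<close>

text \<open>For \<open>0 \<le> a \<le> b\<close> with \<open>b\<close> in the set,
  \<open>z a z\<close> and \<open>z (b - a) z\<close> are positive with sum zero, so both vanish;
  with \<open>a = c * c\<close> this gives \<open>c * z = 0\<close>. Hence a self-adjoint element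
  orthogonal to \<open>x\<close> is orthogonal to the hereditary hull of \<open>x\<close>.\<close>

lemma hereditary_subalgebra_annihilator:
  fixes z :: "'a::cstar_algebra"
  assumes z: "star z = z"
  shows "hereditary_subalgebra {b. b * z = 0 \<and> z * b = 0}"
proof -
  let ?B = "{b. b * z = 0 \<and> z * b = 0}"
  have "closed {b. b * z = 0 \<and> z * b = 0}"
    by (intro closed_Collect_conj closed_Collect_eq continuous_intros)
  moreover have "star x * z = 0 \<and> z * star x = 0" if "x * z = 0" "z * x = 0" for x
    using star_mult[of x z] star_mult[of z x] that by (simp add: z star_zero)
  moreover have "z * (x * y) = 0" if "z * x = 0" for x y
    by (simp add: that flip: mult.assoc)
  ultimately have "cstar_subalgebra ?B"
    unfolding cstar_subalgebra_def
    by (simp add: distrib_left distrib_right mult.assoc mult_scaleC_left mult_scaleC_right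
        scaleC_zero_right)
  moreover have "a * z = 0 \<and> z * a = 0"
    if b: "b * z = 0" "z * b = 0" and a: "positive_elem a" "positive_elem (b - a)" for a b
  proof -
    obtain c d where c: "star c = c" "a = c * c" and d: "star d = d" "b - a = d * d"
      using a unfolding positive_elem_iff_square by blast
    have sq: "star (x * z) * (x * z) = z * (x * x) * z" if "star x = x" for x
      by (simp add: star_mult that z mult.assoc)
    have "z * (b - a) * z = - (z * a * z)"
      by (simp add: right_diff_distrib left_diff_distrib b)
    then have "positive_elem (z * a * z)" "positive_elem (- (z * a * z))"
      using positive_elem_star_mult_self[of "c * z"] positive_elem_star_mult_self[of "d * z"]
      by (simp_all add: sq[OF c(1)] sq[OF d(1)] c(2) flip: d(2))
    then have "star (c * z) * (c * z) = 0"
      unfolding sq[OF c(1)] c(2) by (rule positive_elem_antisym)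
    then have cz: "c * z = 0" by (rule star_mult_self_eq_0)
    then have az: "a * z = 0" by (simp add: c(2) mult.assoc)
    have "z * a = star (a * z)" by (simp add: star_mult z positive_elem_star[OF a(1)])
    with az show ?thesis by (simp add: star_zero)
  qed
  ultimately show ?thesis unfolding hereditary_subalgebra_def by blast
qed

lemma hereditary_hull_orthogonal:
  assumes "star z = z" "x * z = 0" "z * x = 0" "q \<in> hereditary_hull x"
  shows "q * z = 0" "z * q = 0"
  using hereditary_subalgebra_annihilator[OF assms(1)] assms(2-) unfolding hereditary_hull_def
  by blast+

section \<open>Orthogonal positive elements in a nonscalar algebra\<close>

lemma exists_nonscalar_self_adjoint:
  assumes "range (\<lambda>z. z *\<^sub>C (1::'a::cstar_algebra)) \<noteq> UNIV"
  obtains h :: "'a::cstar_algebra" where "star h = h" "\<And>z. h \<noteq> z *\<^sub>C 1"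
proof -
  obtain s :: 'a where s: "\<And>z. s \<noteq> z *\<^sub>C 1" using assms by auto
  let ?A = "s + star s" and ?B = "\<i> *\<^sub>C (s - star s)"
  have sa: "star ?A = ?A" "star ?B = ?B"
    by (simp_all add: star_add star_diff star_star star_scaleC scaleC_minus_left
        flip: scaleC_minus_right)
  have "(\<forall>z. ?A \<noteq> z *\<^sub>C 1) \<or> (\<forall>z. ?B \<noteq> z *\<^sub>C 1)"
  proof (rule ccontr)
    assume "\<not> ?thesis"
    then obtain u v where u: "?A = u *\<^sub>C 1" and v: "?B = v *\<^sub>C 1" by blast
    have "s + s = ?A - \<i> *\<^sub>C ?B"
      by (simp add: scaleC_scaleC scaleC_minus_left scaleC_one)
    also have "\<dots> = (u - \<i> * v) *\<^sub>C 1"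
      unfolding u v by (simp add: scaleC_scaleC scaleC_diff_left)
    finally have "(1/2) *\<^sub>R (s + s) = ((u - \<i> * v) / 2) *\<^sub>C 1"
      by (simp add: scaleC_scaleC flip: scaleC_of_real)
    then show False using s by simp
  qed
  then show ?thesis using sa that by blast
qed

lemma norm_one:
  assumes "(1::'a::cstar_algebra) \<noteq> 0"
  shows "norm (1::'a) = 1"
proof -
  have "(norm (1::'a))\<^sup>2 = norm (1::'a)" using norm_star_mult[of "1::'a"] by (simp add: star_one)
  then show ?thesis using assms by (simp add: power2_eq_square)
qed

lemma positive_elem_norm_minus:
  "positive_elem a \<Longrightarrow> positive_elem (norm a *\<^sub>R 1 - a)"
  by (rule positive_elem_of_norm_diff[where t = "norm a"])
     (simp_all add: star_diff star_scaleR star_one positive_elem_star)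

text \<open>For a function h, the number t below is the midpoint of its range.\<close>

lemma eq_scalar_of_midpoint_le:
  fixes h :: "'a::cstar_algebra"
  assumes h: "star h = h"
  defines "t \<equiv> (norm (norm h *\<^sub>R 1 + h) - norm (norm h *\<^sub>R 1 - h)) / 2"
  assumes pos: "positive_elem (h - t *\<^sub>R 1)"
  shows "h = t *\<^sub>R 1"
proof (cases "(1::'a) = 0")
  case True
  have "h = h * 1" by simp
  also have "\<dots> = 0" by (simp only: True mult_zero_right)
  finally show ?thesis by (simp add: True)
next
  case False
  \<comment> \<open>Shifting by \<open>m\<close> gives positive elements, so
    \<open>\<alpha> - m\<close> is the maximum and \<open>m - \<beta>\<close> the minimum of the
    spectrum of \<open>h\<close>.\<close>
  define m where "m = norm h"
  define \<alpha> where "\<alpha> = norm (m *\<^sub>R 1 + h)"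
  define \<beta> where "\<beta> = norm (m *\<^sub>R 1 - h)"
  have t: "t = (\<alpha> - \<beta>) / 2" by (simp add: t_def m_def \<alpha>_def \<beta>_def)
  have p: "positive_elem (m *\<^sub>R 1 + h)" "positive_elem (m *\<^sub>R 1 - h)"
    by (rule positive_elem_of_norm_diff[where t = m];
        simp add: star_add star_diff star_scaleR star_one h m_def)+
  have "\<alpha> \<le> 2 * m" "0 \<le> \<beta>"
    using norm_triangle_ineq[of "m *\<^sub>R 1" h] by (simp_all add: \<alpha>_def \<beta>_def m_def norm_one[OF False])
  have "(m - t) *\<^sub>R 1 - (m *\<^sub>R 1 - h) = h - t *\<^sub>R 1" by (simp add: algebra_simps)
  then have "positive_elem ((m - t) *\<^sub>R 1 - (m *\<^sub>R 1 - h))" using pos by (simp only:)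
  then have "\<beta> \<le> m - t"
    unfolding \<beta>_def
    by (rule positive_elem_norm_le[OF p(2)]) (use \<open>\<alpha> \<le> 2 * m\<close> \<open>0 \<le> \<beta>\<close> t in simp)
  moreover have "2 * m \<le> \<alpha> + \<beta>"
  proof -
    have "(m *\<^sub>R 1 + h) + (m *\<^sub>R 1 - h) = (2 * m) *\<^sub>R 1" by (simp add: scaleR_2 flip: scaleR_scaleR)
    then have "norm ((m *\<^sub>R 1 + h) + (m *\<^sub>R 1 - h)) = 2 * m"
      by (simp only: norm_scaleR norm_one[OF False]) (simp add: m_def)
    then show ?thesis
      using norm_triangle_ineq[of "m *\<^sub>R 1 + h" "m *\<^sub>R 1 - h"] by (simp add: \<alpha>_def \<beta>_def)
  qed
  \<comment> \<open>A minimum not below the midpoint makes the maximum equal to \<open>t\<close>,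
    hence \<open>h \<le> t\<close> as well.\<close>
  ultimately have "\<alpha> - m = t" using t by (intro antisym) (simp_all add: field_simps)
  then have "\<alpha> *\<^sub>R 1 - (m *\<^sub>R 1 + h) = - (h - t *\<^sub>R 1)" by (auto simp: algebra_simps)
  then have "positive_elem (- (h - t *\<^sub>R 1))"
    using positive_elem_norm_minus[OF p(1)] by (simp only: \<alpha>_def)
  then have "h - t *\<^sub>R 1 = 0" by (rule positive_elem_antisym[OF pos])
  then show ?thesis by simp
qed

text \<open>The witnesses are the positive and negative parts of \<open>h - t\<close>, with
  \<open>t\<close> the midpoint of the spectrum of a nonscalar \<open>h\<close>. If one vanished,
  \<open>h\<close> would lie on one side of \<open>t\<close> and be scalar; the upper side is
  reduced to the lower by \<open>- h\<close>, whose midpoint is \<open>- t\<close>.\<close>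

lemma exists_orthogonal_positive:
  assumes "range (\<lambda>z. z *\<^sub>C (1::'a::cstar_algebra)) \<noteq> UNIV"
  obtains x y :: "'a::cstar_algebra" where "positive_elem x" "positive_elem y" "x \<noteq> 0" "y \<noteq> 0"
    "x * y = 0" "y * x = 0"
proof -
  obtain h :: 'a where h: "star h = h" and ns: "\<And>z. h \<noteq> z *\<^sub>C 1"
    using exists_nonscalar_self_adjoint[OF assms] by metis
  define t where "t = (norm (norm h *\<^sub>R 1 + h) - norm (norm h *\<^sub>R 1 - h)) / 2"
  have nt: "h \<noteq> t *\<^sub>R 1" using ns by (metis scaleC_of_real)
  have "star (h - t *\<^sub>R 1) = h - t *\<^sub>R 1" by (simp add: star_diff star_scaleR star_one h)
  then obtain p n where pn: "positive_elem p" "positive_elem n" "h - t *\<^sub>R 1 = p - n"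
    "p * n = 0" "n * p = 0"
    by (metis positive_decomposition)
  have "n \<noteq> 0"
    using nt pn(1,3) eq_scalar_of_midpoint_le[OF h] by (auto simp: t_def)
  moreover have "p \<noteq> 0"
  proof
    assume "p = 0"
    then have "n = - (h - t *\<^sub>R 1)" using pn(3) by simp
    then have "positive_elem (- h - (- t) *\<^sub>R 1)" using pn(2) by simp
    then have "- h = (- t) *\<^sub>R 1"
      using eq_scalar_of_midpoint_le[of "- h"] by (simp add: star_minus h t_def minus_divide_left)
    with nt show False by simp
  qed
  ultimately show ?thesis using pn by (intro that)
qed

section \<open>Two-by-two matrices and cancellation\<close>

definition mat2 :: "'a \<Rightarrow> 'a \<Rightarrow> 'a \<Rightarrow> 'a \<Rightarrow> 'a mat" where
  "mat2 a b c d = mat 2 2 (\<lambda>(i, j). if i = 0 then (if j = 0 then a else b)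
     else (if j = 0 then c else d))"

lemma mat2_carrier [simp]: "mat2 a b c d \<in> carrier_mat 2 2"
  by (simp add: mat2_def)

lemma mat2_eq_iff [simp]:
  "mat2 a b c d = mat2 a' b' c' d' \<longleftrightarrow> a = a' \<and> b = b' \<and> c = c' \<and> d = d'"
proof
  assume eq: "mat2 a b c d = mat2 a' b' c' d'"
  have "mat2 a b c d $$ (i, j) = mat2 a' b' c' d' $$ (i, j)" for i j by (simp add: eq)
  from this[of 0 0] this[of 0 1] this[of 1 0] this[of 1 1]
  show "a = a' \<and> b = b' \<and> c = c' \<and> d = d'" by (simp add: mat2_def)
qed simp

lemma mat2_cases:
  assumes "A \<in> carrier_mat 2 2"
  obtains a b c d where "A = mat2 a b c d"
proof (rule that)
  show "A = mat2 (A $$ (0, 0)) (A $$ (0, 1)) (A $$ (1, 0)) (A $$ (1, 1))"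
    using assms by (intro eq_matI) (auto simp: mat2_def less_2_cases_iff)
qed

lemma mat2_add: "mat2 a b c d + mat2 a' b' c' d' = mat2 (a + a') (b + b') (c + c') (d + d')"
  by (rule eq_matI) (auto simp: mat2_def less_2_cases_iff)

lemma mat2_mult:
  fixes a b c d :: "'a::cstar_algebra"
  shows "mat2 a b c d * mat2 a' b' c' d'
    = mat2 (a * a' + b * c') (a * b' + b * d') (c * a' + d * c') (c * b' + d * d')"
  by (rule eq_matI) (auto simp: mat2_def less_2_cases_iff scalar_prod_def numeral_2_eq_2)

lemma mat2_star: "mat_star (mat2 a b c d) = mat2 (star a) (star c) (star b) (star d)"
  by (rule eq_matI) (auto simp: mat2_def mat_star_def less_2_cases_iff)

lemma zero_mat2: "0\<^sub>m 2 2 = mat2 0 0 0 0"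
  by (rule eq_matI) (auto simp: mat2_def)

lemma is_projection_complement: "is_projection p \<Longrightarrow> is_projection (1 - p)"
  by (simp add: is_projection_def star_diff star_one algebra_simps)

lemma star_mult_sum_eq_0:
  assumes "star x * x + star y * y = (0::'a::cstar_algebra)"
  shows "x = 0"
proof -
  have "star y * y = - (star x * x)" using assms by (simp add: eq_neg_iff_add_eq_0 add.commute)
  then have "positive_elem (- (star x * x))" using positive_elem_star_mult_self[of y] by simp
  then show ?thesis
    using positive_elem_antisym positive_elem_star_mult_self star_mult_self_eq_0 by blast
qed

text \<open>The unit splits in two ways: diag(p, 1 - p) ~ 1 ~ diag(1 - q, q) ~ diag(1 - q, 1 - p).
  Cancelling the common summand \<open>1 - p\<close> leaves the claim.\<close>

lemma cancellation_complement:
  fixes p q :: "'a::cstar_algebra"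
  assumes canc: "has_cancellation TYPE('a)"
    and p: "is_projection p" and q: "is_projection q" and "mvn_equiv (1 - p) q"
  shows "mvn_equiv p (1 - q)"
proof -
  obtain w where w: "star w * w = 1 - p" "w * star w = q"
    using assms(4) unfolding mvn_equiv_def by blast
  note pp = p[unfolded is_projection_def] and qq = q[unfolded is_projection_def]
  have "w * star w * w = w"
    by (rule star_mult_imp_partial_isometry) (simp add: w is_projection_complement p)
  then have qw: "q * w = w" by (simp add: w)
  have wq: "star w * q = star w" using arg_cong[OF qw, of star] by (simp add: star_mult qq)
  have q2: "q * (q * x) = q * x" and p2: "p * (p * x) = p * x"
    and qw2: "q * (w * x) = w * x" and ww2: "w * (star w * x) = q * x" for x
    using pp qq qw w(2) by (metis mult.assoc)+
  \<comment> \<open>\<open>V\<close> is the column with entries \<open>1 - q\<close> and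
    \<open>star w\<close>, an isometry onto diag(1 - q, 1 - p), times the row with entries
    \<open>p\<close> and \<open>1 - p\<close>, a coisometry with source projection diag(p, 1 -
    p).\<close>
  define V where "V = mat2 ((1 - q) * p) ((1 - q) * (1 - p)) (star w * p) (star w * (1 - p))"
  let ?P = "mat2 p 0 0 0" and ?Q = "mat2 (1 - q) 0 0 0" and ?R = "mat2 0 0 0 (1 - p)"
  have sV: "mat_star V = mat2 (p * (1 - q)) (p * w) ((1 - p) * (1 - q)) ((1 - p) * w)"
    by (simp add: V_def mat2_star star_mult star_diff star_one star_star pp qq)
  have "mat_star V * V = ?P + ?R" "V * mat_star V = ?Q + ?R"
    unfolding sV unfolding V_def
    by (simp_all add: mat2_mult mat2_add pp qq algebra_simps p2 q2 qw2 ww2 qw wq w)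
  then have "mat_mvn_equiv 2 (?P + ?R) (?Q + ?R)"
    unfolding mat_mvn_equiv_def by (intro bexI[of _ V]) (simp_all add: V_def)
  moreover have "mat_projection 2 ?P" "mat_projection 2 ?Q" "mat_projection 2 ?R"
      "?P * ?R = 0\<^sub>m 2 2" "?Q * ?R = 0\<^sub>m 2 2"
    using pp qq
    by (simp_all add: mat_projection_def mat2_mult mat2_star zero_mat2 star_zero star_diff star_one
        algebra_simps)
  ultimately have "mat_mvn_equiv 2 ?P ?Q"
    using canc unfolding has_cancellation_def by blast
  then obtain U where "U \<in> carrier_mat 2 2" and U: "mat_star U * U = ?P" "U * mat_star U = ?Q"
    unfolding mat_mvn_equiv_def by blast
  then obtain a b c d where abcd: "U = mat2 a b c d" by (metis mat2_cases)
  \<comment> \<open>The zero lower right corners of \<open>?P\<close> and \<open>?Q\<close> force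
    \<open>b = 0\<close> and \<open>c = 0\<close>, so \<open>a\<close> alone implements the
    equivalence.\<close>
  have e: "star a * a + star c * c = p" "star b * b + star d * d = 0"
    "a * star a + b * star b = 1 - q" "c * star c + d * star d = 0"
    using U unfolding abcd by (simp_all add: mat2_mult mat2_star)
  have "b = 0" by (rule star_mult_sum_eq_0[OF e(2)])
  moreover have "star c = 0" by (rule star_mult_sum_eq_0[of _ "star d"]) (simp add: star_star e(4))
  then have "c = 0" by (metis star_star star_zero)
  ultimately show ?thesis using e(1,3) unfolding mvn_equiv_def by auto
qed

section \<open>Crossed products\<close>

locale finite_group_action = group G for G :: "('g, 'm) monoid_scheme" (structure) +
  fixes \<alpha> :: "'g \<Rightarrow> 'a::cstar_algebra \<Rightarrow> 'a"
  assumes finite_carrier: "finite (carrier G)" and action: "cstar_action G \<alpha>"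
begin

lemma automorphism: "g \<in> carrier G \<Longrightarrow> star_automorphism (\<alpha> g)"
  using action unfolding cstar_action_def by blast

lemma action_mult: "g \<in> carrier G \<Longrightarrow> \<alpha> g (x * y) = \<alpha> g x * \<alpha> g y"
  using automorphism unfolding star_automorphism_def by blast

lemma action_star: "g \<in> carrier G \<Longrightarrow> \<alpha> g (star x) = star (\<alpha> g x)"
  using automorphism unfolding star_automorphism_def by blast

lemmas action_zero = star_automorphism_zero[OF automorphism]
  and action_one = star_automorphism_one[OF automorphism]

lemma action_identity: "\<alpha> \<one> x = x"
proof -
  have "\<alpha> \<one> (\<alpha> \<one> x) = \<alpha> \<one> x"
    using action one_closed unfolding cstar_action_def by (metis comp_apply r_one)
  moreover have "inj (\<alpha> \<one>)"
    using automorphism[OF one_closed] unfolding star_automorphism_def by (simp add: bij_is_inj)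
  ultimately show ?thesis by (meson injD)
qed

text \<open>Automorphisms carry projections to projections, so the C*-identity bounds the image of a
  partial isometry.\<close>

lemma norm_action_le_1:
  assumes "g \<in> carrier G" "is_projection (star x * x)"
  shows "norm (\<alpha> g x) \<le> 1"
proof -
  have "star (\<alpha> g x) * \<alpha> g x = \<alpha> g (star x * x)"
    by (simp add: action_mult action_star assms(1))
  moreover have "is_projection (\<alpha> g (star x * x))"
    using assms by (simp add: is_projection_def flip: action_mult action_star)
  ultimately have "(norm (\<alpha> g x))\<^sup>2 \<le> 1"
    using norm_star_mult[of "\<alpha> g x"] norm_projection_le_1 by fastforce
  then show ?thesis by (simp add: power_le_one_iff)
qed

section \<open>Arithmetic, norm and closed ideals of the crossed product\<close>

lemma crossed_embed_carrier: "crossed_embed G x \<in> crossed_carrier G"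
  by (auto simp: crossed_embed_def crossed_carrier_def)

lemma crossed_mult_embed_left:
  assumes "f \<in> crossed_carrier G"
  shows "crossed_mult G \<alpha> (crossed_embed G a) f = (\<lambda>k. a * f k)"
proof
  fix k
  have "(\<Sum>g\<in>carrier G. crossed_embed G a g * \<alpha> g (f (inv g \<otimes> k)))
      = (\<Sum>g\<in>carrier G. if g = \<one> then a * \<alpha> \<one> (f (inv \<one> \<otimes> k)) else 0)"
    by (rule sum.cong) (auto simp: crossed_embed_def)
  then show "crossed_mult G \<alpha> (crossed_embed G a) f k = a * f k"
    using assms by (auto simp: crossed_mult_def crossed_carrier_def finite_carrier action_identity)
qed

text \<open>Coefficients stand to the left of the unitaries, and
  \<open>\<lambda>\<^sub>k b = \<alpha>\<^sub>k(b) \<lambda>\<^sub>k\<close>.\<close>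

lemma crossed_mult_embed_right:
  assumes "f \<in> crossed_carrier G"
  shows "crossed_mult G \<alpha> f (crossed_embed G b) = (\<lambda>k. f k * \<alpha> k b)"
proof
  fix k
  show "crossed_mult G \<alpha> f (crossed_embed G b) k = f k * \<alpha> k b"
  proof (cases "k \<in> carrier G")
    case True
    have "inv g \<otimes> k = \<one> \<longleftrightarrow> g = k" if "g \<in> carrier G" for g
      using that True inv_solve_left'[of \<one> g k] by auto
    then have "(\<Sum>g\<in>carrier G. f g * \<alpha> g (crossed_embed G b (inv g \<otimes> k)))
        = (\<Sum>g\<in>carrier G. if g = k then f k * \<alpha> k b else 0)"
      by (intro sum.cong) (auto simp: crossed_embed_def action_zero)
    then show ?thesis using True by (simp add: crossed_mult_def finite_carrier)
  next
    case False
    then show ?thesis using assms by (simp add: crossed_mult_def crossed_carrier_def)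
  qed
qed

lemma crossed_mult_carrier: "crossed_mult G \<alpha> f h \<in> crossed_carrier G"
  by (simp add: crossed_mult_def crossed_carrier_def)

lemma crossed_projection_eq:
  "crossed_projection G = (\<lambda>k. if k \<in> carrier G then (1 / real (card (carrier G))) *\<^sub>R 1 else 0)"
  by (auto simp: crossed_projection_def crossed_unitary_def finite_carrier fun_eq_iff)

lemma crossed_projection_carrier: "crossed_projection G \<in> crossed_carrier G"
  by (auto simp: crossed_projection_eq crossed_carrier_def)

lemma crossed_norm_le:
  assumes "f \<in> crossed_carrier G"
  shows "crossed_norm G \<alpha> f \<le> (\<Sum>g\<in>carrier G. norm (f g))"
  unfolding crossed_norm_def
proof (rule cSUP_least)
  \<comment> \<open>The zero seminorm is admissible, so the supremum is over a nonempty set and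
    inherits the bound of its members.\<close>
  have "crossed_seminorm G \<alpha> (\<lambda>_. 0)"
    by (simp add: crossed_seminorm_def sum_nonneg)
  then show "{N. crossed_seminorm G \<alpha> N} \<noteq> {}" by blast
qed (use assms in \<open>auto simp: crossed_seminorm_def\<close>)

lemma crossed_carrier_closed_ideal: "crossed_closed_ideal G \<alpha> (crossed_carrier G)"
  unfolding crossed_closed_ideal_def
  by (auto simp: crossed_mult_carrier) (auto simp: crossed_carrier_def scaleC_zero_right)

lemma closed_ideal_sum:
  assumes J: "crossed_closed_ideal G \<alpha> J" and "finite A" "\<And>h. h \<in> A \<Longrightarrow> F h \<in> J"
  shows "(\<lambda>k. \<Sum>h\<in>A. F h k) \<in> J"
  using assms(2,3) J
  by (induction A rule: finite_induct) (auto simp: crossed_closed_ideal_def)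

lemma saturatedI:
  assumes "\<And>J. crossed_closed_ideal G \<alpha> J \<Longrightarrow> crossed_projection G \<in> J \<Longrightarrow> crossed_embed G 1 \<in> J"
  shows "saturated G \<alpha>"
proof -
  have "J = crossed_carrier G" if J: "crossed_closed_ideal G \<alpha> J" "crossed_projection G \<in> J" for J
  proof
    show "crossed_carrier G \<subseteq> J"
    proof
      fix f :: "'g \<Rightarrow> 'a" assume f: "f \<in> crossed_carrier G"
      then have "crossed_mult G \<alpha> (crossed_embed G 1) f \<in> J"
        using assms[OF J] J(1) unfolding crossed_closed_ideal_def by blast
      then show "f \<in> J" by (simp add: crossed_mult_embed_left f)
    qed
  qed (use J in \<open>simp add: crossed_closed_ideal_def\<close>)
  \<comment> \<open>The family is a singleton; its being nonempty keeps the intersection inside the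
    carrier.\<close>
  then have "{J. crossed_closed_ideal G \<alpha> J \<and> crossed_projection G \<in> J} = {crossed_carrier G}"
    using crossed_carrier_closed_ideal crossed_projection_carrier by blast
  then show ?thesis by (simp add: saturated_def)
qed

lemma is_projection_sum:
  assumes "orthogonal_projections G e"
  shows "is_projection (\<Sum>g\<in>carrier G. e g)"
proof -
  have "(\<Sum>g\<in>carrier G. e g) * (\<Sum>g\<in>carrier G. e g)
      = (\<Sum>g\<in>carrier G. \<Sum>h\<in>carrier G. if g = h then e g else 0)"
    unfolding sum_product using assms
    by (intro sum.cong) (auto simp: orthogonal_projections_def is_projection_def)
  moreover have "star (\<Sum>g\<in>carrier G. e g) = (\<Sum>g\<in>carrier G. star (e g))"
    by (rule linear_sum[OF bounded_linear.linear[OF bounded_linear_star]])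
  ultimately show ?thesis
    using assms by (simp add: is_projection_def orthogonal_projections_def finite_carrier)
qed

text \<open>The free factors \<open>a\<close> and \<open>b\<close> allow a partial isometry to move
  the corner from the sum of the \<open>e h\<close> to an equivalent projection. The error is
  measured by coefficient norms, which dominate the crossed product norm.\<close>

lemma corner_near_ideal:
  assumes J: "crossed_closed_ideal G \<alpha> J" "crossed_projection G \<in> J"
    and e: "orthogonal_projections G e"
    and \<epsilon>: "\<And>g h. g \<in> carrier G \<Longrightarrow> h \<in> carrier G \<Longrightarrow> norm (\<alpha> g (e h) - e (g \<otimes> h)) < \<epsilon>"
    and a: "norm a \<le> 1" and b: "\<And>g. g \<in> carrier G \<Longrightarrow> norm (\<alpha> g b) \<le> 1"
  shows "\<exists>j\<in>J. (\<Sum>g\<in>carrier G. norm (crossed_embed G (a * (\<Sum>h\<in>carrier G. e h) * b) g - j g))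
    \<le> (real (card (carrier G)))\<^sup>2 * \<epsilon>"
proof
  define n where "n = real (card (carrier G))"
  have n: "n > 0" using finite_carrier by (auto simp: n_def card_gt_0_iff)
  \<comment> \<open>The factor \<open>n\<close> cancels the weight \<open>1 / n\<close> in the
    averaging projection, so the coefficient at \<open>\<one>\<close> is
    \<open>a * e h * b\<close>.\<close>
  define F where "F h = crossed_mult G \<alpha> (crossed_mult G \<alpha> (crossed_embed G (n *\<^sub>R (a * e h)))
    (crossed_projection G)) (crossed_embed G (e h * b))" for h
  have F: "F h k = a * (e h * \<alpha> k (e h)) * \<alpha> k b" if "k \<in> carrier G" for h k
    unfolding F_def crossed_mult_embed_right[OF crossed_mult_carrier]
    unfolding crossed_mult_embed_left[OF crossed_projection_carrier]
    using n that by (simp add: crossed_projection_eq action_mult mult.assoc flip: n_def)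
  have "F h \<in> J" for h
    using J crossed_embed_carrier unfolding F_def crossed_closed_ideal_def by blast
  then show "(\<lambda>k. \<Sum>h\<in>carrier G. F h k) \<in> J"
    by (intro closed_ideal_sum J(1) finite_carrier)
  have 1: "crossed_embed G (a * (\<Sum>h\<in>carrier G. e h) * b) \<one> = (\<Sum>h\<in>carrier G. F h \<one>)"
    using e by (simp add: F crossed_embed_def action_identity sum_distrib_left sum_distrib_right
        orthogonal_projections_def is_projection_def)
  have small: "norm (F h g) \<le> \<epsilon>" if g: "g \<in> carrier G" "g \<noteq> \<one>" and h: "h \<in> carrier G" for g h
  proof -
    have "g \<otimes> h \<noteq> h" using g h by simp
    then have 0: "e h * e (g \<otimes> h) = 0"
      using e g h unfolding orthogonal_projections_def by (metis m_closed)
    have "norm (e h) \<le> 1"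
      using e h by (simp add: orthogonal_projections_def norm_projection_le_1)
    have "norm (F h g) \<le> norm a * norm (e h * \<alpha> g (e h)) * norm (\<alpha> g b)"
      unfolding F[OF g(1)] by (meson norm_mult_ineq order_trans mult_right_mono norm_ge_zero)
    also have "\<dots> \<le> 1 * norm (e h * \<alpha> g (e h)) * 1"
      by (intro mult_mono a b g) simp_all
    also have "norm (e h * \<alpha> g (e h)) = norm (e h * (\<alpha> g (e h) - e (g \<otimes> h)))"
      by (simp add: right_diff_distrib 0)
    also have "\<dots> \<le> norm (e h) * norm (\<alpha> g (e h) - e (g \<otimes> h))" by (rule norm_mult_ineq)
    also have "\<dots> \<le> 1 * \<epsilon>"
      using \<epsilon>[OF g(1) h] \<open>norm (e h) \<le> 1\<close> by (intro mult_mono) simp_all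
    finally show ?thesis by simp
  qed
  have "norm (\<alpha> \<one> (e \<one>) - e (\<one> \<otimes> \<one>)) < \<epsilon>" by (rule \<epsilon>) simp_all
  then have "0 \<le> \<epsilon>" using norm_ge_zero order_trans less_imp_le by blast
  \<comment> \<open>The coefficient at \<open>\<one>\<close> is exact; every other one is a sum of
    \<open>n\<close> terms of size at most \<open>\<epsilon>\<close>.\<close>
  have "norm (crossed_embed G (a * (\<Sum>h\<in>carrier G. e h) * b) g - (\<Sum>h\<in>carrier G. F h g)) \<le> n * \<epsilon>"
    if g: "g \<in> carrier G" for g
  proof (cases "g = \<one>")
    case True
    then show ?thesis using 1 n \<open>0 \<le> \<epsilon>\<close> by simp
  next
    case False
    then have "norm (\<Sum>h\<in>carrier G. F h g) \<le> (\<Sum>h\<in>carrier G. \<epsilon>)"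
      by (intro sum_norm_le small g)
    then show ?thesis using False by (simp add: crossed_embed_def n_def)
  qed
  then have "(\<Sum>g\<in>carrier G. norm (crossed_embed G (a * (\<Sum>h\<in>carrier G. e h) * b) g
      - (\<Sum>h\<in>carrier G. F h g))) \<le> (\<Sum>g\<in>carrier G. n * \<epsilon>)"
    by (rule sum_mono)
  then show "(\<Sum>g\<in>carrier G. norm (crossed_embed G (a * (\<Sum>h\<in>carrier G. e h) * b) g
      - (\<Sum>h\<in>carrier G. F h g))) \<le> (real (card (carrier G)))\<^sup>2 * \<epsilon>"
    by (simp add: n_def power2_eq_square)
qed

lemma closed_ideal_memI:
  assumes J: "crossed_closed_ideal G \<alpha> J" and f: "f \<in> crossed_carrier G"
    and "\<And>\<epsilon>. 0 < \<epsilon> \<Longrightarrow>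
      \<exists>j\<in>J. (\<Sum>g\<in>carrier G. norm (f g - j g)) \<le> (real (card (carrier G)))\<^sup>2 * \<epsilon>"
  shows "f \<in> J"
proof -
  have "\<exists>j\<in>J. crossed_norm G \<alpha> (\<lambda>g. f g - j g) < \<delta>" if "0 < \<delta>" for \<delta>
  proof -
    let ?n = "real (card (carrier G))"
    have n: "0 < ?n" using finite_carrier by (auto simp: card_gt_0_iff)
    \<comment> \<open>This choice makes the total error at most \<open>\<delta> / 2\<close>,
      strictly below \<open>\<delta>\<close>.\<close>
    with that obtain j where j: "j \<in> J"
      "(\<Sum>g\<in>carrier G. norm (f g - j g)) \<le> ?n\<^sup>2 * (\<delta> / (2 * ?n\<^sup>2))"
      using assms(3)[of "\<delta> / (2 * ?n\<^sup>2)"] by auto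
    have "(\<lambda>g. f g - j g) \<in> crossed_carrier G"
      using f j(1) J unfolding crossed_closed_ideal_def by (auto simp: crossed_carrier_def)
    from crossed_norm_le[OF this] j(2) have "crossed_norm G \<alpha> (\<lambda>g. f g - j g) \<le> \<delta> / 2"
      using n by simp
    with that j(1) show ?thesis by (intro bexI[of _ j]) auto
  qed
  then show ?thesis using J f unfolding crossed_closed_ideal_def by blast
qed

section \<open>Saturation under each Rokhlin property\<close>

lemma saturated_of_rokhlin:
  assumes "rokhlin_property G \<alpha>"
  shows "saturated G \<alpha>"
proof (rule saturatedI, rule closed_ideal_memI[OF _ crossed_embed_carrier], assumption)
  fix J and \<epsilon> :: real
  assume J: "crossed_closed_ideal G \<alpha> J" "crossed_projection G \<in> J" and "0 < \<epsilon>"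
  then obtain e where e: "orthogonal_projections G e"
    "\<And>g h. g \<in> carrier G \<Longrightarrow> h \<in> carrier G \<Longrightarrow> norm (\<alpha> g (e h) - e (g \<otimes> h)) < \<epsilon>"
    "(\<Sum>g\<in>carrier G. e g) = 1"
    using assms[unfolded rokhlin_property_def, rule_format, of "{}" \<epsilon>] by blast
  have "norm (\<alpha> g 1) \<le> 1" if "g \<in> carrier G" for g
    by (simp add: action_one that norm_one_le_1)
  \<comment> \<open>With \<open>a = b = 1\<close> and projections summing to 1, the corner is the
    unit of the crossed product.\<close>
  from corner_near_ideal[OF J e(1,2) norm_one_le_1 this]
  show "\<exists>j\<in>J. (\<Sum>g\<in>carrier G. norm (crossed_embed G 1 g - j g)) \<le> (real (card (carrier G)))\<^sup>2 * \<epsilon>"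
    by (simp add: e(3))
qed

text \<open>Cancellation supplies \<open>v\<close> from the sum \<open>f\<close> of the
  \<open>e g\<close> to \<open>1 - q\<close>, and \<open>v * f * star v = 1 - q\<close>, so the
  corner estimate is used with factors \<open>a * v\<close> and \<open>star v\<close>. The factor
  \<open>a\<close> stays free because \<open>p * (1 - q)\<close> is approximated later.\<close>

lemma tracial_complement_near_ideal:
  assumes tr: "tracial_rokhlin_property G \<alpha>" and canc: "has_cancellation TYPE('a)"
    and x: "positive_elem x" "x \<noteq> 0" and \<epsilon>: "0 < \<epsilon>"
    and J: "crossed_closed_ideal G \<alpha> J" "crossed_projection G \<in> J"
  obtains q where "q \<in> hereditary_hull x" "is_projection q"
    "\<And>a. norm a \<le> 1 \<Longrightarrow> \<exists>j\<in>J. (\<Sum>g\<in>carrier G. norm (crossed_embed G (a * (1 - q)) g - j g))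
       \<le> (real (card (carrier G)))\<^sup>2 * \<epsilon>"
proof -
  obtain e q where e: "orthogonal_projections G e"
    "\<And>g h. g \<in> carrier G \<Longrightarrow> h \<in> carrier G \<Longrightarrow> norm (\<alpha> g (e h) - e (g \<otimes> h)) < \<epsilon>"
    and q: "q \<in> hereditary_hull x" "is_projection q" "mvn_equiv (1 - (\<Sum>g\<in>carrier G. e g)) q"
    using tr[unfolded tracial_rokhlin_property_def, rule_format, of "{}" \<epsilon> x] x \<epsilon> by blast
  note f = is_projection_sum[OF e(1)]
  obtain v where v: "star v * v = (\<Sum>g\<in>carrier G. e g)" "v * star v = 1 - q"
    using cancellation_complement[OF canc f q(2,3)] unfolding mvn_equiv_def by blast
  have "v * (\<Sum>g\<in>carrier G. e g) * star v = (1 - q) * (1 - q)"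
    by (simp flip: v add: mult.assoc)
  then have vfv: "v * (\<Sum>g\<in>carrier G. e g) * star v = 1 - q"
    using is_projection_complement[OF q(2)] by (simp add: is_projection_def)
  have nv: "norm v \<le> 1"
    using norm_action_le_1[of \<one> v] f by (simp add: v(1) action_identity)
  have nsv: "norm (\<alpha> g (star v)) \<le> 1" if "g \<in> carrier G" for g
    by (rule norm_action_le_1[OF that]) (simp add: star_star v is_projection_complement q)
  show ?thesis
  proof (rule that[OF q(1,2)])
    fix a :: 'a assume "norm a \<le> 1"
    then have "norm (a * v) \<le> 1"
      using norm_mult_ineq[of a v] nv by (simp add: mult_le_one order_trans)
    from corner_near_ideal[OF J e this nsv]
    show "\<exists>j\<in>J. (\<Sum>g\<in>carrier G. norm (crossed_embed G (a * (1 - q)) g - j g))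
       \<le> (real (card (carrier G)))\<^sup>2 * \<epsilon>"
      by (simp add: mult.assoc flip: vfv)
  qed
qed

text \<open>The nonscalar assumption provides two orthogonal directions. For scalar M, taking every
  \<open>e g\<close> zero satisfies the tracial condition and cancellation holds, yet for a
  nontrivial group the averaging projection generates only a one-dimensional ideal.\<close>

lemma saturated_of_tracial_rokhlin:
  assumes tr: "tracial_rokhlin_property G \<alpha>" and canc: "has_cancellation TYPE('a)"
    and ns: "range (\<lambda>z. z *\<^sub>C (1::'a)) \<noteq> UNIV"
  shows "saturated G \<alpha>"
proof (rule saturatedI, rule closed_ideal_memI[OF _ crossed_embed_carrier], assumption)
  fix J and \<epsilon> :: real
  assume J: "crossed_closed_ideal G \<alpha> J" "crossed_projection G \<in> J" and "0 < \<epsilon>"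
  then have \<epsilon>: "0 < \<epsilon> / 2" by simp
  let ?near = "\<lambda>x j. (\<Sum>g\<in>carrier G. norm (crossed_embed G x g - j g))"
  let ?n = "real (card (carrier G))"
  obtain x y :: 'a where xy: "positive_elem x" "positive_elem y" "x \<noteq> 0" "y \<noteq> 0"
    "x * y = 0" "y * x = 0"
    using exists_orthogonal_positive[OF ns] by metis
  obtain p where p: "p \<in> hereditary_hull x" "is_projection p"
    "\<And>a. norm a \<le> 1 \<Longrightarrow> \<exists>j\<in>J. ?near (a * (1 - p)) j \<le> ?n\<^sup>2 * (\<epsilon> / 2)"
    using tracial_complement_near_ideal[OF tr canc xy(1,3) \<epsilon> J] by metis
  obtain q where q: "q \<in> hereditary_hull y" "is_projection q"
    "\<And>a. norm a \<le> 1 \<Longrightarrow> \<exists>j\<in>J. ?near (a * (1 - q)) j \<le> ?n\<^sup>2 * (\<epsilon> / 2)"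
    using tracial_complement_near_ideal[OF tr canc xy(2,4) \<epsilon> J] by metis
  \<comment> \<open>Orthogonality passes to the hulls in two stages: \<open>y\<close> annihilates
    \<open>x\<close>, hence \<open>p\<close>; then \<open>p\<close> annihilates \<open>y\<close>,
    hence \<open>q\<close>.\<close>
  have "p * y = 0" "y * p = 0"
    using hereditary_hull_orthogonal[OF positive_elem_star[OF xy(2)] xy(5,6) p(1)] by auto
  then have "p * q = 0"
    using hereditary_hull_orthogonal(2)[OF _ _ _ q(1), of p] p(2) by (simp add: is_projection_def)
  then have one: "1 * (1 - p) + p * (1 - q) = 1" by (simp add: right_diff_distrib)
  obtain j k where j: "j \<in> J" "?near (1 * (1 - p)) j \<le> ?n\<^sup>2 * (\<epsilon> / 2)"
    and k: "k \<in> J" "?near (p * (1 - q)) k \<le> ?n\<^sup>2 * (\<epsilon> / 2)"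
    using p(3)[OF norm_one_le_1] q(3)[OF norm_projection_le_1[OF p(2)]] by blast
  show "\<exists>j\<in>J. ?near 1 j \<le> ?n\<^sup>2 * \<epsilon>"
  proof
    show "(\<lambda>g. j g + k g) \<in> J" using J(1) j(1) k(1) unfolding crossed_closed_ideal_def by blast
    have "?near 1 (\<lambda>g. j g + k g) \<le> ?near (1 * (1 - p)) j + ?near (p * (1 - q)) k"
      unfolding sum.distrib[symmetric]
    proof (rule sum_mono)
      fix g
      have "crossed_embed G 1 g - (j g + k g)
          = (crossed_embed G (1 * (1 - p)) g - j g) + (crossed_embed G (p * (1 - q)) g - k g)"
        using one by (simp add: crossed_embed_def algebra_simps)
      then show "norm (crossed_embed G 1 g - (j g + k g))
          \<le> norm (crossed_embed G (1 * (1 - p)) g - j g) + norm (crossed_embed G (p * (1 - q)) g - k g)"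
        by (simp only: norm_triangle_ineq)
    qed
    also have "\<dots> \<le> ?n\<^sup>2 * \<epsilon>" using j(2) k(2) by simp
    finally show "?near 1 (\<lambda>g. j g + k g) \<le> ?n\<^sup>2 * \<epsilon>" .
  qed
qed

end

theorem proposition4p9:
  fixes G :: "('g, 'm) monoid_scheme"
    and \<alpha> :: "'g \<Rightarrow> 'a::cstar_algebra \<Rightarrow> 'a"
  assumes "group G" and "finite (carrier G)"
    and "cstar_action G \<alpha>"
    and "rokhlin_property G \<alpha> \<or>
         (tracial_rokhlin_property G \<alpha> \<and> has_cancellation TYPE('a) \<and>
          range (\<lambda>z. z *\<^sub>C (1::'a)) \<noteq> UNIV)"
  shows "saturated G \<alpha>"
proof -
  interpret finite_group_action G \<alpha>
    using assms(1-3) by (simp add: finite_group_action_def finite_group_action_axioms_def)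
  show ?thesis using assms(4) saturated_of_rokhlin saturated_of_tracial_rokhlin by blast
qed

end
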